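(* Let $X$ and $Y$ be separable Banach spaces. If $X$ has the almost Daugavet property, then so does $X\oplus_1 Y$.
   Context: Banach spaces are over the scalar field $\mathbb{K}\in\{\mathbb{R},\mathbb{C}\}$. $X\oplus_1 Y$ denotes the direct sum $X\times Y$ with the norm $\|(x,y)\|=\|x\|+\|y\|$. For a Banach space $X$, $X^*$ denotes its dual, and $S_W$ denotes the unit sphere of a normed space $W$. A linear subspace $W\subset X^*$ is called norming if $\sup_{w^*\in S_W}|w^*(x)|=\|x\|$ for every $x\in X$. For $x\in X$ and $w^*\in X^*$, $w^*\otimes x$ denotes the operator $X\to X$, $z\mapsto w^*(z)x$. $X$ has the Daugavet property with respect to a subspace $W\subset X^*$ if $\|\operatorname{Id}+T\|=1+\|T\|$ holds for every operator $T=w^*\otimes x$ with $x\in X$ and $w^*\in W$ (the zero operator is included here, so the space $\{0\}$ does not qualify; for nonzero spaces including it makes no difference). $X$ has the almost Daugavet property if it has the Daugavet property with respect to some norming subspace $W\subset X^*$. *)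

theory Defs
  imports "HOL-Analysis.Analysis"
begin

section \<open>Banach spaces over a scalar field\<close>

text \<open>
  The class \<open>banach\<close> only provides real scalars.  The following locale adds to a
  real Banach space a multiplication by scalars from a normed field \<open>'k\<close> that extends the given
  real one and for which the given norm is homogeneous.  For \<open>'k = complex\<close> these are
  precisely the complex Banach spaces; for \<open>'k = real\<close> the multiplication can only be
  \<open>scaleR\<close>.  All notions below take this multiplication as a parameter, so that the real
  case is obtained from \<open>scaleR\<close>.
\<close>

locale banach_over = vector_space scale
  for scale :: "'k::real_normed_field \<Rightarrow> 'a::banach \<Rightarrow> 'a" +
  assumes scale_of_real: "scale (of_real r) x = r *\<^sub>R x"
    and norm_scale: "norm (scale c x) = norm c * norm x"

lemma banach_over_scaleR: "banach_over (scaleR :: real \<Rightarrow> 'a::banach \<Rightarrow> 'a)"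
  by unfold_locales (simp_all add: algebra_simps)

text \<open>
  A functional in \<open>'a \<Rightarrow>\<^sub>L 'k\<close> is bounded but only real-linear, hence the extra condition.
  The norm of \<open>'a \<Rightarrow>\<^sub>L 'k\<close> is the operator norm, i.e. the dual norm.
\<close>

definition dual_space :: "('k::real_normed_field \<Rightarrow> 'a::banach \<Rightarrow> 'a) \<Rightarrow> ('a \<Rightarrow>\<^sub>L 'k) set" where
  "dual_space s = {f. \<forall>c x. blinfun_apply f (s c x) = c * blinfun_apply f x}"

definition dual_scale :: "'k::real_normed_field \<Rightarrow> ('a::banach \<Rightarrow>\<^sub>L 'k) \<Rightarrow> ('a \<Rightarrow>\<^sub>L 'k)" where
  "dual_scale c f = blinfun_mult_right c o\<^sub>L f"

lemma dual_scale_apply [simp]: "blinfun_apply (dual_scale c f) x = c * blinfun_apply f x"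
  by (simp add: dual_scale_def)

lemma module_dual_scale: "module dual_scale"
  by unfold_locales
    (auto intro!: blinfun_eqI simp: blinfun.add_left blinfun.add_right algebra_simps)

definition dual_subspace ::
  "('k::real_normed_field \<Rightarrow> 'a::banach \<Rightarrow> 'a) \<Rightarrow> ('a \<Rightarrow>\<^sub>L 'k) set \<Rightarrow> bool" where
  "dual_subspace s W \<longleftrightarrow> W \<subseteq> dual_space s \<and> module.subspace dual_scale W"


section \<open>The Daugavet property\<close>

text \<open>
  The supremum is over a set bounded by \<open>norm x\<close>.  For \<open>W = {0}\<close> the unit sphere of \<open>W\<close> is
  empty and the real supremum is some fixed number; then the condition fails for some \<open>x\<close>
  unless the space is \<open>{0}\<close>, and \<open>{0}\<close> does not have the Daugavet property with respect to
  any \<open>W\<close>.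
\<close>

definition norming :: "('a::banach \<Rightarrow>\<^sub>L 'k::real_normed_field) set \<Rightarrow> bool" where
  "norming W \<longleftrightarrow> (\<forall>x. (SUP w\<in>W \<inter> sphere 0 1. norm (blinfun_apply w x)) = norm x)"

definition tensor_op ::
  "('k::real_normed_field \<Rightarrow> 'a::banach \<Rightarrow> 'a) \<Rightarrow> ('a \<Rightarrow>\<^sub>L 'k) \<Rightarrow> 'a \<Rightarrow> ('a \<Rightarrow> 'a)" where
  "tensor_op s w x = (\<lambda>z. s (blinfun_apply w z) x)"

definition daugavet_wrt ::
  "('k::real_normed_field \<Rightarrow> 'a::banach \<Rightarrow> 'a) \<Rightarrow> ('a \<Rightarrow>\<^sub>L 'k) set \<Rightarrow> bool" where
  "daugavet_wrt s W \<longleftrightarrow>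
     (\<forall>w\<in>W. \<forall>x. onorm (\<lambda>z. z + tensor_op s w x z) = 1 + onorm (tensor_op s w x))"

definition almost_daugavet :: "('k::real_normed_field \<Rightarrow> 'a::banach \<Rightarrow> 'a) \<Rightarrow> bool" where
  "almost_daugavet s \<longleftrightarrow>
     (\<exists>W. dual_subspace s W \<and> norming W \<and> daugavet_wrt s W)"


section \<open>The l1-sum of two Banach spaces\<close>

text \<open>A type of its own, since the product type carries the Euclidean sum of the two norms.\<close>

datatype ('a, 'b) l1_sum = L1_Pair (l1_fst: 'a) (l1_snd: 'b)

instantiation l1_sum :: (real_normed_vector, real_normed_vector) real_normed_vector
begin

definition zero_l1_sum :: "('a, 'b) l1_sum" where
  "0 = L1_Pair 0 0"

definition plus_l1_sum :: "('a, 'b) l1_sum \<Rightarrow> ('a, 'b) l1_sum \<Rightarrow> ('a, 'b) l1_sum" where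
  "p + q = L1_Pair (l1_fst p + l1_fst q) (l1_snd p + l1_snd q)"

definition minus_l1_sum :: "('a, 'b) l1_sum \<Rightarrow> ('a, 'b) l1_sum \<Rightarrow> ('a, 'b) l1_sum" where
  "p - q = L1_Pair (l1_fst p - l1_fst q) (l1_snd p - l1_snd q)"

definition uminus_l1_sum :: "('a, 'b) l1_sum \<Rightarrow> ('a, 'b) l1_sum" where
  "- p = L1_Pair (- l1_fst p) (- l1_snd p)"

definition scaleR_l1_sum :: "real \<Rightarrow> ('a, 'b) l1_sum \<Rightarrow> ('a, 'b) l1_sum" where
  "r *\<^sub>R p = L1_Pair (r *\<^sub>R l1_fst p) (r *\<^sub>R l1_snd p)"

definition norm_l1_sum :: "('a, 'b) l1_sum \<Rightarrow> real" where
  "norm_l1_sum p = norm (l1_fst p) + norm (l1_snd p)"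

definition dist_l1_sum :: "('a, 'b) l1_sum \<Rightarrow> ('a, 'b) l1_sum \<Rightarrow> real" where
  "dist_l1_sum p q = norm (p - q)"

definition sgn_l1_sum :: "('a, 'b) l1_sum \<Rightarrow> ('a, 'b) l1_sum" where
  "sgn_l1_sum p = inverse (norm p) *\<^sub>R p"

definition uniformity_l1_sum :: "(('a, 'b) l1_sum \<times> ('a, 'b) l1_sum) filter" where
  "uniformity_l1_sum = (INF e\<in>{0<..}. principal {(p, q). dist p q < e})"

definition open_l1_sum :: "('a, 'b) l1_sum set \<Rightarrow> bool" where
  "open_l1_sum U \<longleftrightarrow> (\<forall>p\<in>U. \<forall>\<^sub>F (p', q) in uniformity. p' = p \<longrightarrow> q \<in> U)"

instance
proof
  fix p q :: "('a, 'b) l1_sum" and r :: real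
  show "norm p = 0 \<longleftrightarrow> p = 0"
    by (cases p) (simp add: norm_l1_sum_def zero_l1_sum_def add_nonneg_eq_0_iff)
  show "norm (p + q) \<le> norm p + norm q"
    using norm_triangle_ineq[of "l1_fst p" "l1_fst q"] norm_triangle_ineq[of "l1_snd p" "l1_snd q"]
    by (simp add: norm_l1_sum_def plus_l1_sum_def)
  show "norm (r *\<^sub>R p) = \<bar>r\<bar> * norm p"
    by (simp add: norm_l1_sum_def scaleR_l1_sum_def distrib_left)
qed (simp_all add: zero_l1_sum_def plus_l1_sum_def minus_l1_sum_def uminus_l1_sum_def
    scaleR_l1_sum_def dist_l1_sum_def sgn_l1_sum_def uniformity_l1_sum_def open_l1_sum_def
    algebra_simps)

end

instance l1_sum :: (banach, banach) banach
proof
  fix P :: "nat \<Rightarrow> ('a, 'b) l1_sum"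
  assume "Cauchy P"
  have "Cauchy (\<lambda>n. l1_fst (P n))" "Cauchy (\<lambda>n. l1_snd (P n))"
  proof -
    have le: "dist (l1_fst p) (l1_fst q) \<le> dist p q" "dist (l1_snd p) (l1_snd q) \<le> dist p q"
      for p q :: "('a, 'b) l1_sum"
      by (simp_all add: dist_norm norm_l1_sum_def minus_l1_sum_def)
    show "Cauchy (\<lambda>n. l1_fst (P n))" "Cauchy (\<lambda>n. l1_snd (P n))"
      using \<open>Cauchy P\<close> le unfolding Cauchy_def by (meson order_le_less_trans)+
  qed
  then obtain a b where a: "(\<lambda>n. l1_fst (P n)) \<longlonglongrightarrow> a" and b: "(\<lambda>n. l1_snd (P n)) \<longlonglongrightarrow> b"
    by (meson Cauchy_convergent convergentD)
  have "(\<lambda>n. dist (l1_fst (P n)) a + dist (l1_snd (P n)) b) \<longlonglongrightarrow> 0"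
    using tendsto_add[OF a[THEN tendsto_dist_iff[THEN iffD1]] b[THEN tendsto_dist_iff[THEN iffD1]]]
    by simp
  then have "(\<lambda>n. dist (P n) (L1_Pair a b)) \<longlonglongrightarrow> 0"
    by (simp add: dist_norm norm_l1_sum_def minus_l1_sum_def)
  then show "convergent P"
    by (auto simp: convergent_def intro: tendsto_dist_iff[THEN iffD2])
qed

definition l1_scale ::
  "('k \<Rightarrow> 'a \<Rightarrow> 'a) \<Rightarrow> ('k \<Rightarrow> 'b \<Rightarrow> 'b) \<Rightarrow> 'k \<Rightarrow> ('a, 'b) l1_sum \<Rightarrow> ('a, 'b) l1_sum" where
  "l1_scale sX sY c p = L1_Pair (sX c (l1_fst p)) (sY c (l1_snd p))"

lemma l1_scale_scaleR: "l1_scale scaleR scaleR = scaleR"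
  by (simp add: fun_eq_iff l1_scale_def scaleR_l1_sum_def)

lemma banach_over_l1_scale:
  assumes "banach_over sX" "banach_over sY"
  shows "banach_over (l1_scale sX sY)"
proof -
  interpret X: banach_over sX by fact
  interpret Y: banach_over sY by fact
  show ?thesis
    by unfold_locales
      (simp_all add: l1_scale_def plus_l1_sum_def scaleR_l1_sum_def norm_l1_sum_def
        X.scale_of_real Y.scale_of_real X.norm_scale Y.norm_scale
        X.scale_right_distrib Y.scale_right_distrib X.scale_left_distrib Y.scale_left_distrib
        distrib_left)
qed

end

theory Submission
  imports Defs
begin

text \<open>
  The scalar-free notion that carries the property from \<open>X\<close> to the sum is
  \<open>thickness_two\<close>: for finitely many vectors \<open>x\<close> and any \<open>\<epsilon> > 0\<close> there is one \<open>e\<close> in the unit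
  ball with \<open>norm x + 1 - \<epsilon> \<le> norm (x + e)\<close> for all of them.  It passes from \<open>X\<close> to the
  \<open>l\<^sub>1\<close>-sum with any \<open>Y\<close>, because perturbing the first coordinate leaves the norm of the
  second untouched (\<open>thickness_two_l1_sum\<close>).  So it suffices to connect it with the almost
  Daugavet property in both directions.

  If \<open>X\<close> has the Daugavet property with respect to a norming \<open>W\<close>, then each slice of the unit
  ball given by a functional in \<open>W\<close> contains a smaller such slice on which a given \<open>x\<close> is nearly
  \<open>l\<^sub>1\<close>-additive.  Shrinking the slice once for each of finitely many vectors gives the
  required \<open>e\<close> (\<open>almost_daugavet_imp_thickness_two\<close>).

  Conversely, let the space be separable with thickness two, and let \<open>d\<close> run through a
  normalised dense sequence, taking each of its values infinitely often.  Unit balls of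
  finite-dimensional subspaces are totally bounded, so one can choose inductively \<open>e n\<close> in the
  unit ball that is almost \<open>l\<^sub>1\<close>-orthogonal to the span \<open>E n\<close> of \<open>d 0, ..., d n\<close> and
  \<open>e 0, ..., e (n - 1)\<close>.  Let \<open>W\<close> be the space of all functionals \<open>w\<close> with
  \<open>w (e n) = w (d n)\<close> for all large \<open>n\<close>.

  \<^item> \<open>W\<close> has the Daugavet property: \<open>w\<close> is almost as large as its norm at some value \<open>y\<close> of \<open>d\<close>, hence
    equally large at \<open>e n\<close> for infinitely many \<open>n\<close>, and for these \<open>norm (e n + w (e n) x)\<close>
    approaches \<open>1 + norm (w (y) x)\<close>.

  \<^item> \<open>W\<close> is norming: replacing \<open>e n\<close> by \<open>d n\<close> in a vector of the span does not increase the
    norm by more than a factor close to 1, since \<open>norm (u + c d n) \<le> norm u + norm c\<close>, which is almost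
    \<open>norm (u + c e n)\<close>.  Iterating, a vector of \<open>E m\<close> has almost its full norm as its distance from the span of
    the differences \<open>e n - d n\<close> with \<open>n \<ge> m\<close>, and the Hahn-Banach theorem
    supplies a functional that vanishes on this span.
\<close>

section \<open>The Hahn-Banach theorem for sublinear functionals\<close>

definition sublinear :: "('a::real_vector \<Rightarrow> real) \<Rightarrow> bool" where
  "sublinear p \<longleftrightarrow> (\<forall>x y. p (x + y) \<le> p x + p y) \<and> (\<forall>r x. 0 \<le> r \<longrightarrow> p (r *\<^sub>R x) = r * p x)"

lemma sublinear_add: "sublinear p \<Longrightarrow> p (x + y) \<le> p x + p y"
  and sublinear_scaleR: "sublinear p \<Longrightarrow> 0 \<le> r \<Longrightarrow> p (r *\<^sub>R x) = r * p x"
  by (simp_all add: sublinear_def)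

lemma sublinear_zero: "sublinear p \<Longrightarrow> p 0 = 0"
  using sublinear_scaleR[of p 0 0] by simp

lemma sublinear_minus: "sublinear p \<Longrightarrow> - p (- x) \<le> p x"
  using sublinear_add[of p x "- x"] sublinear_zero[of p] by simp

lemma sublinearI:
  assumes add: "\<And>x y. p (x + y) \<le> p x + p y"
    and zero: "p 0 = 0"
    and le: "\<And>r x. 0 < r \<Longrightarrow> p (r *\<^sub>R x) \<le> r * p x"
  shows "sublinear p"
  unfolding sublinear_def
proof (intro conjI allI impI)
  show "p (x + y) \<le> p x + p y" for x y by (fact add)
  fix r :: real and x assume "0 \<le> r"
  show "p (r *\<^sub>R x) = r * p x"
  proof (cases "r = 0")
    case False
    with \<open>0 \<le> r\<close> have "0 < r" by simp
    then have "p x \<le> inverse r * p (r *\<^sub>R x)"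
      using le[of "inverse r" "r *\<^sub>R x"] by simp
    with \<open>0 < r\<close> le[of r x] show ?thesis by (simp add: field_simps)
  qed (simp add: zero)
qed

text \<open>
  On the ray from \<open>y\<close> in direction \<open>x\<close> the functional \<open>p\<close> grows at most with slope \<open>p x\<close>; \<open>q y\<close> is
  the infimum of \<open>p\<close> on the ray after subtracting this slope.  A minimal sublinear functional
  equals its own \<open>q\<close>, which makes it odd and therefore linear; for an arbitrary \<open>p\<close>, passing to
  \<open>q\<close> first forces every linear functional below \<open>q\<close> to agree with \<open>p\<close> at \<open>x\<close>.
\<close>

lemma sublinear_tilt:
  assumes p: "sublinear p"
  shows "\<exists>q. sublinear q \<and> (\<forall>y. q y \<le> p y) \<and> q (- x) \<le> - p x"
proof -
  define q where "q y = (INF t\<in>{0..}. p (y + t *\<^sub>R x) - t * p x)" for y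
  have bdd: "bdd_below ((\<lambda>t. p (y + t *\<^sub>R x) - t * p x) ` {0..})" for y
  proof (rule bdd_belowI2)
    fix t :: real assume "t \<in> {0..}"
    then show "- p (- y) \<le> p (y + t *\<^sub>R x) - t * p x"
      using sublinear_add[OF p, of "y + t *\<^sub>R x" "- y"] sublinear_scaleR[OF p, of t x] by simp
  qed
  have lower: "q y \<le> p (y + t *\<^sub>R x) - t * p x" if "0 \<le> t" for t y
    unfolding q_def using that by (intro cINF_lower bdd) auto
  have greatest: "c \<le> q y" if "\<And>t. 0 \<le> t \<Longrightarrow> c \<le> p (y + t *\<^sub>R x) - t * p x" for c y
    unfolding q_def using that by (intro cINF_greatest) auto
  have "sublinear q"
  proof (rule sublinearI)
    fix y z
    have "q (y + z) - (p (z + t *\<^sub>R x) - t * p x) \<le> q y" if "0 \<le> t" for t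
    proof (rule greatest)
      fix u :: real assume "0 \<le> u"
      have "q (y + z) \<le> p (y + z + (u + t) *\<^sub>R x) - (u + t) * p x"
        using \<open>0 \<le> t\<close> \<open>0 \<le> u\<close> by (intro lower) simp
      also have "\<dots> \<le> p (y + u *\<^sub>R x) + p (z + t *\<^sub>R x) - (u + t) * p x"
        using sublinear_add[OF p, of "y + u *\<^sub>R x" "z + t *\<^sub>R x"] by (simp add: algebra_simps)
      finally show "q (y + z) - (p (z + t *\<^sub>R x) - t * p x) \<le> p (y + u *\<^sub>R x) - u * p x"
        by (simp add: algebra_simps)
    qed
    then have "q (y + z) - q y \<le> q z"
      by (intro greatest) (simp add: algebra_simps)
    then show "q (y + z) \<le> q y + q z" by simp
  next
    show "q 0 = 0"
    proof (rule antisym)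
      show "q 0 \<le> 0" using lower[of 0 0] sublinear_zero[OF p] by simp
      show "0 \<le> q 0" using sublinear_scaleR[OF p] by (intro greatest) simp
    qed
  next
    fix r :: real and y assume "0 < r"
    have "q (r *\<^sub>R y) / r \<le> q y"
    proof (rule greatest)
      fix t :: real assume "0 \<le> t"
      have "q (r *\<^sub>R y) \<le> p (r *\<^sub>R y + (r * t) *\<^sub>R x) - (r * t) * p x"
        using \<open>0 < r\<close> \<open>0 \<le> t\<close> by (intro lower) simp
      also have "\<dots> = r * (p (y + t *\<^sub>R x) - t * p x)"
        using \<open>0 < r\<close> sublinear_scaleR[OF p, of r "y + t *\<^sub>R x"]
        by (simp add: algebra_simps)
      finally show "q (r *\<^sub>R y) / r \<le> p (y + t *\<^sub>R x) - t * p x"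
        using \<open>0 < r\<close> by (simp add: field_simps)
    qed
    then show "q (r *\<^sub>R y) \<le> r * q y" using \<open>0 < r\<close> by (simp add: field_simps)
  qed
  moreover have "q y \<le> p y" for y using lower[of 0 y] by simp
  moreover have "q (- x) \<le> - p x" using lower[of 1 "- x"] sublinear_zero[OF p] by simp
  ultimately show ?thesis by blast
qed

text \<open>
  Zorn's lemma for the pointwise order.  Every functional of a chain lies above \<open>- p (- x)\<close> at
  \<open>x\<close>, so the pointwise infimum exists; it is subadditive because any two members of the chain
  have a common lower bound in it.
\<close>

lemma sublinear_minimal_exists:
  assumes p: "sublinear p"
  obtains m where "sublinear m" "\<And>x. m x \<le> p x"
    "\<And>q. sublinear q \<Longrightarrow> (\<And>x. q x \<le> m x) \<Longrightarrow> q = m"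
proof -
  define A where "A = {q. sublinear q \<and> (\<forall>x. q x \<le> p x)}"
  have "\<exists>m\<in>A. \<forall>q\<in>A. m \<ge> q \<longrightarrow> q = m"
  proof (rule predicate_Zorn)
    show "partial_order_on A (relation_of (\<ge>) A)"
      by (rule partial_order_on_relation_ofI) auto
    fix C assume "C \<in> Chains (relation_of (\<ge>) A)"
    then have CA: "C \<subseteq> A" and chain: "\<And>f g. f \<in> C \<Longrightarrow> g \<in> C \<Longrightarrow> f \<ge> g \<or> g \<ge> f"
      by (auto simp: Chains_def relation_of_def)
    show "\<exists>u\<in>A. \<forall>a\<in>C. a \<ge> u"
    proof (cases "C = {}")
      case True
      with p show ?thesis by (auto simp: A_def)
    next
      case False
      define u where "u x = (INF f\<in>C. f x)" for x
      have sub: "sublinear f" "f x \<le> p x" if "f \<in> C" for f x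
        using that CA by (auto simp: A_def)
      have bdd: "bdd_below ((\<lambda>f. f x) ` C)" for x
      proof (rule bdd_belowI2)
        fix f assume "f \<in> C"
        then show "- p (- x) \<le> f x"
          using sublinear_minus[OF sub(1), of f x] sub(2)[of f "- x"] by simp
      qed
      have lower: "u x \<le> f x" if "f \<in> C" for f x
        unfolding u_def using that by (intro cINF_lower bdd)
      have greatest: "c \<le> u x" if "\<And>f. f \<in> C \<Longrightarrow> c \<le> f x" for c x
        unfolding u_def using that False by (intro cINF_greatest)
      have "sublinear u"
      proof (rule sublinearI)
        fix x y
        have "u (x + y) - g y \<le> u x" if "g \<in> C" for g
        proof (rule greatest)
          fix f assume "f \<in> C"
          obtain h where h: "h \<in> C" "h \<le> f" "h \<le> g"
            using chain[OF \<open>f \<in> C\<close> \<open>g \<in> C\<close>] \<open>f \<in> C\<close> \<open>g \<in> C\<close> by blast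
          have "u (x + y) \<le> h x + h y"
            using lower[OF h(1), of "x + y"] sublinear_add[OF sub(1)[OF h(1)], of x y] by simp
          also have "\<dots> \<le> f x + g y"
            using h(2,3) by (intro add_mono) (auto simp: le_fun_def)
          finally show "u (x + y) - g y \<le> f x" by simp
        qed
        then have "u (x + y) - u x \<le> u y"
          by (intro greatest) (simp add: algebra_simps)
        then show "u (x + y) \<le> u x + u y" by simp
      next
        show "u 0 = 0"
          using False by (simp add: u_def sublinear_zero[OF sub(1)] cong: INF_cong)
      next
        fix r :: real and x assume "0 < r"
        have "u (r *\<^sub>R x) / r \<le> u x"
        proof (rule greatest)
          fix f assume "f \<in> C"
          then show "u (r *\<^sub>R x) / r \<le> f x"
            using lower[OF \<open>f \<in> C\<close>, of "r *\<^sub>R x"] sublinear_scaleR[OF sub(1), of f r x] \<open>0 < r\<close>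
            by (simp add: field_simps)
        qed
        then show "u (r *\<^sub>R x) \<le> r * u x" using \<open>0 < r\<close> by (simp add: field_simps)
      qed
      moreover have "u x \<le> p x" for x
        using False lower sub(2) by (meson all_not_in_conv order_trans)
      ultimately show ?thesis
        using lower by (auto simp: A_def le_fun_def)
    qed
  qed
  then obtain m where "m \<in> A" and min: "\<And>q. q \<in> A \<Longrightarrow> q \<le> m \<Longrightarrow> q = m" by blast
  show thesis
  proof (rule that[of m])
    show "sublinear m" "\<And>x. m x \<le> p x" using \<open>m \<in> A\<close> by (auto simp: A_def)
    fix q assume "sublinear q" "\<And>x. q x \<le> m x"
    then show "q = m"
      using \<open>m \<in> A\<close> by (intro min) (auto simp: A_def le_fun_def intro: order_trans)
  qed
qed

lemma linear_below_sublinear: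
  assumes p: "sublinear p"
  obtains f where "linear f" "\<And>x. f x \<le> p x"
proof -
  obtain m where m: "sublinear m" "\<And>x. m x \<le> p x"
    and min: "\<And>q. sublinear q \<Longrightarrow> (\<And>x. q x \<le> m x) \<Longrightarrow> q = m"
    using sublinear_minimal_exists[OF p] by blast
  have neg: "m (- x) = - m x" for x
  proof -
    obtain q where "sublinear q" "\<And>y. q y \<le> m y" "q (- x) \<le> - m x"
      using sublinear_tilt[OF m(1), of x] by blast
    with min[of q] have "m (- x) \<le> - m x" by auto
    with sublinear_minus[OF m(1), of x] show ?thesis by simp
  qed
  have "linear m"
  proof (rule linearI)
    fix x y
    have "m (- x + - y) \<le> m (- x) + m (- y)" by (rule sublinear_add[OF m(1)])
    then have "m x + m y \<le> m (x + y)" using neg[of x] neg[of y] neg[of "x + y"] by simp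
    with sublinear_add[OF m(1), of x y] show "m (x + y) = m x + m y" by simp
  next
    fix r x
    show "m (r *\<^sub>R x) = r *\<^sub>R m x"
    proof (cases "0 \<le> r")
      case True then show ?thesis by (simp add: sublinear_scaleR[OF m(1)])
    next
      case False
      then have "m (- (r *\<^sub>R x)) = - r * m x"
        using sublinear_scaleR[OF m(1), of "- r" x] by simp
      then show ?thesis by (simp add: neg)
    qed
  qed
  with m(2) that show thesis by blast
qed

theorem Hahn_Banach_sublinear:
  assumes p: "sublinear p"
  obtains f where "linear f" "\<And>x. f x \<le> p x" "f x0 = p x0"
proof -
  obtain q where q: "sublinear q" "\<And>y. q y \<le> p y" "q (- x0) \<le> - p x0"
    using sublinear_tilt[OF p, of x0] by blast
  obtain f where f: "linear f" "\<And>x. f x \<le> q x"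
    using linear_below_sublinear[OF q(1)] by blast
  have "- f x0 \<le> - p x0"
    using f(2)[of "- x0"] q(3) by (simp add: linear_neg[OF f(1)])
  moreover have "f x \<le> p x" for x using f(2) q(2) by (rule order_trans)
  ultimately show thesis using f(1) by (intro that[of f]) (auto intro: antisym)
qed

lemma sublinear_infdist:
  fixes Z :: "'a::real_normed_vector set"
  assumes Z: "subspace Z"
  shows "sublinear (\<lambda>x. infdist x Z)"
proof (rule sublinearI)
  have ne: "Z \<noteq> {}" using subspace_0[OF Z] by blast
  have greatest: "c \<le> infdist x Z" if "\<And>z. z \<in> Z \<Longrightarrow> c \<le> norm (x - z)" for c x
    using ne that by (auto simp: infdist_notempty dist_norm intro: cINF_greatest)
  have lower: "infdist x Z \<le> norm (x - z)" if "z \<in> Z" for x z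
    using infdist_le[OF that, of x] by (simp add: dist_norm)
  show "infdist (x + y) Z \<le> infdist x Z + infdist y Z" for x y
  proof -
    have "infdist (x + y) Z - norm (y - z) \<le> infdist x Z" if "z \<in> Z" for z
    proof (rule greatest)
      fix z' assume "z' \<in> Z"
      have "infdist (x + y) Z \<le> norm (x + y - (z' + z))"
        using Z \<open>z \<in> Z\<close> \<open>z' \<in> Z\<close> by (intro lower subspace_add)
      also have "\<dots> \<le> norm (x - z') + norm (y - z)"
        using norm_triangle_ineq[of "x - z'" "y - z"] by (simp add: algebra_simps)
      finally show "infdist (x + y) Z - norm (y - z) \<le> norm (x - z')" by simp
    qed
    then have "infdist (x + y) Z - infdist x Z \<le> infdist y Z"
      by (intro greatest) (simp add: algebra_simps)
    then show ?thesis by simp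
  qed
  show "infdist 0 Z = 0" using subspace_0[OF Z] by (rule infdist_zero)
  fix r :: real and x assume "0 < r"
  have "infdist (r *\<^sub>R x) Z / r \<le> infdist x Z"
  proof (rule greatest)
    fix z assume "z \<in> Z"
    have "infdist (r *\<^sub>R x) Z \<le> norm (r *\<^sub>R x - r *\<^sub>R z)"
      using Z \<open>z \<in> Z\<close> by (intro lower subspace_scale)
    also have "\<dots> = r * norm (x - z)"
      using \<open>0 < r\<close> by (simp flip: scaleR_diff_right)
    finally show "infdist (r *\<^sub>R x) Z / r \<le> norm (x - z)"
      using \<open>0 < r\<close> by (simp add: field_simps)
  qed
  then show "infdist (r *\<^sub>R x) Z \<le> r * infdist x Z" using \<open>0 < r\<close> by (simp add: field_simps)
qed

section \<open>Functionals over real and complex scalars\<close>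

text \<open>
  The part of the structure of the real and complex numbers that the proof uses, so that both
  are treated at once.  The last condition says that real-linear forms on the scalars are
  given by multiplication; it recovers a scalar-linear functional from its real part.
\<close>

locale real_part =
  fixes re :: "'k::{real_normed_field, heine_borel} \<Rightarrow> real"
  assumes re_linear: "linear re"
    and re_le_norm: "re a \<le> norm a"
    and re_one: "re 1 = 1"
    and re_represent: "linear \<phi> \<Longrightarrow> \<exists>a. \<forall>c. \<phi> c = re (c * a)"
begin

lemma re_of_real_mult: "re (of_real r * a) = r * re a"
  using linear_scale[OF re_linear, of r a] by (simp add: scaleR_conv_of_real)

lemma re_add: "re (a + b) = re a + re b"
  by (rule linear_add[OF re_linear])

lemma re_of_real: "re (of_real r) = r"
  using re_of_real_mult[of r 1] by (simp add: re_one)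

end

lemma unit_scalar_rotation:
  fixes a :: "'k::real_normed_field"
  obtains u where "norm u = 1" "u * a = of_real (norm a)"
proof (cases "a = 0")
  case True
  then show ?thesis by (intro that[of 1]) auto
next
  case False
  then show ?thesis
    by (intro that[of "of_real (norm a) / a"]) (auto simp: norm_divide)
qed

lemma (in real_part) re_separates:
  assumes "\<And>c. re (c * a) = 0"
  shows "a = 0"
  using assms[of "inverse a"] re_one by (cases "a = 0") auto

lemma real_part_real: "real_part (\<lambda>a::real. a)"
proof
  show "\<exists>a. \<forall>c. \<phi> c = c * a" if "linear \<phi>" for \<phi> :: "real \<Rightarrow> real"
  proof (intro exI allI)
    show "\<phi> c = c * \<phi> 1" for c using linear_scale[OF that, of c 1] by simp
  qed
qed (auto intro: linearI)

lemma real_part_complex: "real_part Re"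
proof
  show "\<exists>a. \<forall>c. \<phi> c = Re (c * a)" if "linear \<phi>" for \<phi> :: "complex \<Rightarrow> real"
  proof (intro exI allI)
    fix c
    have "\<phi> c = \<phi> (Re c *\<^sub>R 1 + Im c *\<^sub>R \<i>)"
      by (rule arg_cong[of _ _ \<phi>]) (simp add: complex_eq_iff)
    also have "\<dots> = Re (c * Complex (\<phi> 1) (- \<phi> \<i>))"
      using linear_add[OF that] linear_scale[OF that] by simp
    finally show "\<phi> c = Re (c * Complex (\<phi> 1) (- \<phi> \<i>))" .
  qed
qed (auto intro: linearI simp: complex_Re_le_cmod)

context banach_over
begin

lemma scale_scaleR_left: "scale (r *\<^sub>R c) x = r *\<^sub>R scale c x"
  by (simp add: scaleR_conv_of_real scale_of_real flip: scale_scale)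

lemma bounded_linear_scale_left: "bounded_linear (\<lambda>c. scale c x)"
  by (rule bounded_linear_intro[where K = "norm x"])
    (simp_all add: scale_left_distrib scale_scaleR_left norm_scale)

lemma bounded_linear_tensor_op: "bounded_linear (tensor_op scale w x)"
  unfolding tensor_op_def
  by (rule bounded_linear_compose[OF bounded_linear_scale_left blinfun.bounded_linear_right])

lemma bounded_linear_id_plus_tensor_op: "bounded_linear (\<lambda>z. z + tensor_op scale w x z)"
  by (intro bounded_linear_add bounded_linear_ident bounded_linear_tensor_op)

lemma onorm_tensor_op: "onorm (tensor_op scale w x) = norm w * norm x"
proof -
  have "onorm (tensor_op scale w x) = onorm (\<lambda>z. norm x *\<^sub>R blinfun_apply w z)"
    by (simp add: onorm_def tensor_op_def norm_scale mult.commute)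
  also have "\<dots> = norm w * norm x"
    by (simp add: onorm_scaleR blinfun.bounded_linear_right norm_blinfun.rep_eq)
  finally show ?thesis .
qed

lemma subspace_imp_real_subspace: "subspace Z \<Longrightarrow> real_vector.subspace Z"
  unfolding subspace_def real_vector.subspace_def by (metis scale_of_real)

end

lemma dual_spaceD: "w \<in> dual_space s \<Longrightarrow> blinfun_apply w (s c x) = c * blinfun_apply w x"
  by (simp add: dual_space_def)

lemma dual_subspace_closed:
  assumes "dual_subspace s W"
  shows "0 \<in> W" "v \<in> W \<Longrightarrow> w \<in> W \<Longrightarrow> v + w \<in> W" "w \<in> W \<Longrightarrow> dual_scale c w \<in> W"
    "w \<in> W \<Longrightarrow> w \<in> dual_space s"
  using assms module.subspace_0[OF module_dual_scale] module.subspace_add[OF module_dual_scale]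
    module.subspace_scale[OF module_dual_scale]
  by (auto simp: dual_subspace_def)

lemma norm_dual_scale: "norm (dual_scale c f) = norm c * norm f"
proof -
  have "norm (dual_scale c f) = onorm (\<lambda>x. norm c *\<^sub>R blinfun_apply f x)"
    by (simp add: norm_blinfun.rep_eq onorm_def norm_mult)
  also have "\<dots> = norm c * norm f"
    by (simp add: onorm_scaleR blinfun.bounded_linear_right norm_blinfun.rep_eq)
  finally show ?thesis .
qed

lemma almost_norming_functional:
  assumes "norming W" "W \<inter> sphere 0 1 \<noteq> {}" "t < norm x"
  obtains w where "w \<in> W" "norm w = 1" "t < norm (blinfun_apply w x)"
proof -
  have "t < (SUP w\<in>W \<inter> sphere 0 1. norm (blinfun_apply w x))"
    using assms by (simp add: norming_def)
  moreover have "bdd_above ((\<lambda>w. norm (blinfun_apply w x)) ` (W \<inter> sphere 0 1))"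
  proof (rule bdd_aboveI2)
    fix w assume "w \<in> W \<inter> sphere 0 1"
    then show "norm (blinfun_apply w x) \<le> norm x" using norm_blinfun[of w x] by simp
  qed
  ultimately obtain w where "w \<in> W \<inter> sphere 0 1" "t < norm (blinfun_apply w x)"
    using less_cSUP_iff[OF assms(2)] by blast
  then show thesis using that by auto
qed

lemma normingI:
  assumes ne: "W \<inter> sphere 0 1 \<noteq> {}"
    and approx: "\<And>x t. t < norm x \<Longrightarrow> \<exists>w\<in>W. norm w = 1 \<and> t \<le> norm (blinfun_apply w x)"
  shows "norming W"
  unfolding norming_def
proof (intro allI antisym)
  fix x :: 'a
  have le: "norm (blinfun_apply w x) \<le> norm x" if "w \<in> W \<inter> sphere 0 1" for w
    using that norm_blinfun[of w x] by simp
  show "(SUP w\<in>W \<inter> sphere 0 1. norm (blinfun_apply w x)) \<le> norm x"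
    using ne le by (rule cSUP_least)
  show "norm x \<le> (SUP w\<in>W \<inter> sphere 0 1. norm (blinfun_apply w x))"
  proof (rule dense_le)
    fix t assume "t < norm x"
    then obtain w where w: "w \<in> W \<inter> sphere 0 1" and t: "t \<le> norm (blinfun_apply w x)"
      using approx[of t x] by auto
    have "norm (blinfun_apply w x) \<le> (SUP w\<in>W \<inter> sphere 0 1. norm (blinfun_apply w x))"
      by (rule cSUP_upper[OF w]) (auto intro!: bdd_aboveI2[where M = "norm x"] le)
    with t show "t \<le> (SUP w\<in>W \<inter> sphere 0 1. norm (blinfun_apply w x))" by simp
  qed
qed

locale banach_re = banach_over scale + real_part re
  for scale :: "'k::{real_normed_field, heine_borel} \<Rightarrow> 'a::banach \<Rightarrow> 'a" and re :: "'k \<Rightarrow> real"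
begin

text \<open>
  The complexification of a real functional.  The value of \<open>w\<close> at \<open>x\<close> is the scalar that represents
  \<open>c \<mapsto> f (c x)\<close>.  Rotating \<open>x\<close> by a unit scalar turns the bound on \<open>f\<close> into
  the same bound on \<open>w\<close>.
\<close>

lemma dual_functional_with_real_part:
  assumes f: "linear f" and f_le: "\<And>x. f x \<le> norm x"
  obtains w where "w \<in> dual_space scale" "norm w \<le> 1"
    "\<And>x c. re (c * blinfun_apply w x) = f (scale c x)"
proof -
  have "\<exists>a. \<forall>c. f (scale c x) = re (c * a)" for x
  proof (rule re_represent)
    show "linear (\<lambda>c. f (scale c x))"
      using linear_compose[OF bounded_linear.linear[OF bounded_linear_scale_left] f, of x]
      by (simp add: o_def)
  qed
  then obtain g where g: "\<And>x c. f (scale c x) = re (c * g x)" by metis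
  have g_eqI: "g x = a" if "\<And>c. f (scale c x) = re (c * a)" for x a
  proof -
    have "re (c * (g x - a)) = 0" for c
      using g[of c x] that[of c] linear_diff[OF re_linear, of "c * g x" "c * a"]
      by (simp add: right_diff_distrib)
    then show ?thesis using re_separates by fastforce
  qed
  have g_add: "g (x + y) = g x + g y" for x y
    by (rule g_eqI) (simp add: scale_right_distrib linear_add[OF f] g re_add algebra_simps)
  have g_scale: "g (scale c x) = c * g x" for c x
    by (rule g_eqI) (simp add: g mult.assoc)
  have g_le: "norm (g x) \<le> norm x" for x
  proof -
    obtain u where u: "norm u = 1" "u * g x = of_real (norm (g x))"
      by (rule unit_scalar_rotation)
    then have "norm (g x) = f (scale u x)" by (simp add: g re_of_real)
    also have "\<dots> \<le> norm x" using f_le[of "scale u x"] u(1) by (simp add: norm_scale)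
    finally show ?thesis .
  qed
  have bl: "bounded_linear g"
  proof (rule bounded_linear_intro[where K = 1])
    show "g (r *\<^sub>R x) = r *\<^sub>R g x" for r x
      using g_scale[of "of_real r" x] by (simp add: scale_of_real scaleR_conv_of_real)
  qed (simp_all add: g_add g_le)
  show thesis
  proof (rule that[of "Blinfun g"])
    show "Blinfun g \<in> dual_space scale"
      using bl by (simp add: dual_space_def bounded_linear_Blinfun_apply g_scale)
    show "norm (Blinfun g) \<le> 1"
      using bl by (intro norm_blinfun_bound) (simp_all add: bounded_linear_Blinfun_apply g_le)
    show "re (c * blinfun_apply (Blinfun g) x) = f (scale c x)" for x c
      using bl by (simp add: bounded_linear_Blinfun_apply g)
  qed
qed

text \<open>
  Hahn-Banach for the seminorm \<open>infdist _ Z\<close>: a real functional below it is dominated by the norm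
  and vanishes on \<open>Z\<close>, and both pass to its complexification because \<open>Z\<close> is closed under
  scalars.
\<close>

lemma annihilator_functional:
  assumes Z: "subspace Z"
  obtains w where "w \<in> dual_space scale" "norm w \<le> 1"
    "\<And>z. z \<in> Z \<Longrightarrow> blinfun_apply w z = 0" "infdist x Z \<le> norm (blinfun_apply w x)"
proof -
  have RZ: "real_vector.subspace Z" using Z by (rule subspace_imp_real_subspace)
  obtain f where f: "linear f" "\<And>y. f y \<le> infdist y Z" "f x = infdist x Z"
    using Hahn_Banach_sublinear[OF sublinear_infdist[OF RZ], of x] by blast
  have "f y \<le> norm y" for y
    using f(2)[of y] infdist_le[OF subspace_0[OF Z], of y] by simp
  then obtain w where w: "w \<in> dual_space scale" "norm w \<le> 1"
    "\<And>x c. re (c * blinfun_apply w x) = f (scale c x)"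
    using dual_functional_with_real_part[OF f(1)] by blast
  show thesis
  proof (rule that[of w])
    have f0: "f z \<le> 0" if "z \<in> Z" for z
      using f(2)[of z] that by simp
    have "f z = 0" if "z \<in> Z" for z
      using f0[OF that] f0[OF subspace_neg[OF Z that]] linear_neg[OF f(1), of z] by simp
    then show "blinfun_apply w z = 0" if "z \<in> Z" for z
      using that by (intro re_separates) (simp add: w(3) subspace_scale[OF Z])
    have "infdist x Z = re (1 * blinfun_apply w x)"
      unfolding w(3) by (simp add: f(3))
    also have "\<dots> \<le> norm (blinfun_apply w x)" using re_le_norm by simp
    finally show "infdist x Z \<le> norm (blinfun_apply w x)" .
  qed (use w in auto)
qed

end

section \<open>From the almost Daugavet property to thickness two\<close>

text \<open>
  With \<open>- e\<close> in place of \<open>e\<close>: for any finitely many unit vectors some unit vector is almost at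
  distance 2 from each of them, so that the unit sphere has thickness 2.
  Since \<open>x = 0\<close> is admitted, \<open>e\<close> can be taken to be almost of norm 1.
\<close>

definition thickness_two :: "'a::real_normed_vector itself \<Rightarrow> bool" where
  "thickness_two _ \<longleftrightarrow>
     (\<forall>(F::'a set) \<epsilon>. finite F \<longrightarrow> 0 < \<epsilon> \<longrightarrow>
        (\<exists>e. norm e \<le> 1 \<and> (\<forall>x\<in>F. norm x + 1 - \<epsilon> \<le> norm (x + e))))"

lemma thickness_twoD:
  assumes "thickness_two TYPE('a::real_normed_vector)" "finite (F :: 'a set)" "0 < \<epsilon>"
  obtains e where "norm e \<le> 1" "\<And>x. x \<in> F \<Longrightarrow> norm x + 1 - \<epsilon> \<le> norm (x + e)"
  using assms unfolding thickness_two_def by blast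

text \<open>
  The dual form of the Daugavet equation.  A vector \<open>z\<close> at which the identity plus
  \<open>w \<otimes> x\<close> almost attains its norm is tested against a functional \<open>v\<close> of \<open>W\<close>; on the
  dual side this shows that \<open>v + v x * w\<close> has norm almost \<open>1 + norm x\<close>.  Rotating \<open>v\<close> makes
  \<open>v x\<close> a nonnegative real number.
\<close>

lemma (in banach_over) daugavet_functional_large_at:
  assumes W: "dual_subspace scale W" "norming W" "daugavet_wrt scale W" "W \<inter> sphere 0 1 \<noteq> {}"
    and w: "w \<in> W" "norm w = 1" and t: "0 \<le> t" "t < 1 + norm x"
  obtains v a where "v \<in> W" "norm v = 1" "0 \<le> a" "a \<le> norm x"
    "blinfun_apply v x = of_real a" "t < norm (v + dual_scale (of_real a) w)"
proof -
  have "t < onorm (\<lambda>z. z + tensor_op scale w x z)"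
    using W(3) w t by (simp add: daugavet_wrt_def onorm_tensor_op)
  then obtain z where z: "t * norm z < norm (z + scale (blinfun_apply w z) x)"
    using onorm_bound[OF t(1), of "\<lambda>z. z + tensor_op scale w x z"]
    unfolding tensor_op_def not_le[symmetric] by blast
  obtain v where v: "v \<in> W" "norm v = 1"
    "t * norm z < norm (blinfun_apply v (z + scale (blinfun_apply w z) x))"
    using almost_norming_functional[OF W(2,4) z] by blast
  obtain u where u: "norm u = 1" "u * blinfun_apply v x = of_real (norm (blinfun_apply v x))"
    by (rule unit_scalar_rotation)
  let ?a = "norm (blinfun_apply v x)"
  let ?g = "dual_scale u v + dual_scale (of_real ?a) w"
  have "blinfun_apply ?g z = u * blinfun_apply v (z + scale (blinfun_apply w z) x)"
    using dual_spaceD[OF dual_subspace_closed(4)[OF W(1) v(1)]]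
    by (simp add: blinfun.add_left blinfun.add_right distrib_left u(2)[symmetric] algebra_simps)
  then have "t * norm z < norm (blinfun_apply ?g z)"
    using v(3) u(1) by (simp add: norm_mult)
  also have "\<dots> \<le> norm ?g * norm z" by (rule norm_blinfun)
  finally have "t < norm ?g" by (rule mult_right_less_imp_less) simp
  moreover have "?a \<le> norm x" using norm_blinfun[of v x] v(2) by simp
  ultimately show thesis
    using v u W(1)
    by (intro that[of "dual_scale u v" ?a]) (auto simp: norm_dual_scale dual_subspace_closed(2,3))
qed

context banach_re
begin

lemma re_functional_le: "norm w = 1 \<Longrightarrow> norm y \<le> 1 \<Longrightarrow> re (blinfun_apply w y) \<le> 1"
  using re_le_norm[of "blinfun_apply w y"] norm_blinfun[of w y] by simp

text \<open>
  The slice is given by the normalised \<open>v + a w\<close> of \<open>daugavet_functional_large_at\<close>.  Since its norm is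
  almost \<open>1 + a\<close>, a point \<open>y\<close> of the unit ball where it is almost 1 must have both \<open>v y\<close> and
  \<open>w y\<close> almost 1; then \<open>v\<close> witnesses that \<open>norm (x + y)\<close> is almost \<open>norm x + 1\<close>.
\<close>

lemma daugavet_slice_refine:
  assumes W: "dual_subspace scale W" "norming W" "daugavet_wrt scale W" "W \<inter> sphere 0 1 \<noteq> {}"
    and w: "w \<in> W" "norm w = 1" and \<delta>: "0 < \<delta>"
  obtains w' \<delta>' where "w' \<in> W" "norm w' = 1" "0 < \<delta>'"
    "\<And>y. norm y \<le> 1 \<Longrightarrow> 1 - \<delta>' < re (blinfun_apply w' y) \<Longrightarrow>
        1 - \<delta> < re (blinfun_apply w y) \<and> norm x + 1 - \<delta> \<le> norm (x + y)"
proof (cases "x = 0")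
  case True
  have "1 - \<delta> \<le> norm y" if "1 - \<delta> < re (blinfun_apply w y)" for y
    using that re_le_norm[of "blinfun_apply w y"] norm_blinfun[of w y] w(2) by simp
  with True w \<delta> show thesis by (intro that[of w \<delta>]) auto
next
  case False
  \<comment> \<open>The slice condition loses \<open>2 * \<eta> / a\<close> for \<open>w\<close> and \<open>3 * \<eta>\<close> for the norm, with \<open>norm x / 2 \<le> a\<close>.\<close>
  define \<eta> where "\<eta> = Min {\<delta> / 4, \<delta> * norm x / 4, norm x / 2}"
  have \<eta>: "0 < \<eta>" "\<eta> \<le> \<delta> / 4" "\<eta> \<le> \<delta> * norm x / 4" "\<eta> \<le> norm x / 2"
    using False \<delta> by (auto simp: \<eta>_def)
  obtain v a where v: "v \<in> W" "norm v = 1" and a: "0 \<le> a" "a \<le> norm x"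
    and vx: "blinfun_apply v x = of_real a"
    and g: "1 + norm x - \<eta> < norm (v + dual_scale (of_real a) w)"
    by (rule daugavet_functional_large_at[OF W w, of "1 + norm x - \<eta>" x])
      (use \<eta>(1,4) norm_ge_zero[of x] in auto)
  let ?g = "v + dual_scale (of_real a) w"
  have "norm ?g \<le> norm v + norm (dual_scale (of_real a) w)" by (rule norm_triangle_ineq)
  then have N: "norm ?g \<le> 1 + a" using v(2) w(2) a(1) by (simp add: norm_dual_scale)
  have N0: "0 < norm ?g" using g \<eta> norm_ge_zero[of x] by linarith
  have a_ge: "norm x - \<eta> \<le> a" using N g by simp
  define w' where "w' = dual_scale (of_real (inverse (norm ?g))) ?g"
  define \<delta>' where "\<delta>' = \<eta> / (1 + norm x)"
  have \<delta>': "0 < \<delta>'" "\<delta>' * (1 + norm x) = \<eta>"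
    using \<eta>(1) norm_ge_zero[of x] add_pos_nonneg[of 1 "norm x"]
    by (auto simp: \<delta>'_def)
  show thesis
  proof (rule that[of w' \<delta>'])
    show "w' \<in> W"
      unfolding w'_def using W(1) v(1) w(1) by (intro dual_subspace_closed(2,3))
    show "norm w' = 1" using N0 by (simp add: w'_def norm_dual_scale norm_inverse)
    show "0 < \<delta>'" by (fact \<delta>'(1))
    fix y :: 'a assume y: "norm y \<le> 1" "1 - \<delta>' < re (blinfun_apply w' y)"
    have "re (blinfun_apply w' y)
        = inverse (norm ?g) * (re (blinfun_apply v y) + a * re (blinfun_apply w y))"
      by (simp add: w'_def blinfun.add_left re_add re_of_real_mult del: of_real_inverse)
    then have "(1 - \<delta>') * norm ?g < re (blinfun_apply v y) + a * re (blinfun_apply w y)"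
      using y(2) N0 by (simp add: field_simps)
    moreover have "\<delta>' * norm ?g \<le> \<eta>"
      using mult_left_mono[of "norm ?g" "1 + norm x" \<delta>'] N a(2) \<delta>' by simp
    ultimately have sum: "1 + norm x - 2 * \<eta> < re (blinfun_apply v y) + a * re (blinfun_apply w y)"
      using g by (simp add: algebra_simps)
    have le: "re (blinfun_apply v y) \<le> 1" "a * re (blinfun_apply w y) \<le> a"
      using re_functional_le[OF v(2) y(1)] re_functional_le[OF w(2) y(1)] a(1)
      by (simp_all add: mult_left_le)
    have "a * (1 - \<delta>) < a * re (blinfun_apply w y)"
    proof -
      have "\<delta> * norm x / 2 \<le> \<delta> * a"
        using mult_left_mono[of "norm x / 2" a \<delta>] a_ge \<eta>(4) \<delta> by simp
      then show ?thesis using sum le(1) a(2) \<eta>(3) by (simp add: algebra_simps)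
    qed
    then have "1 - \<delta> < re (blinfun_apply w y)"
      using a(1) by (simp add: mult_less_cancel_left)
    moreover have "norm x + 1 - \<delta> \<le> norm (x + y)"
    proof -
      have "norm x + 1 - 3 * \<eta> \<le> a + re (blinfun_apply v y)"
        using sum le(2) \<eta>(1) by simp
      also have "\<dots> = re (blinfun_apply v (x + y))"
        by (simp add: blinfun.add_right re_add vx re_of_real)
      also have "\<dots> \<le> norm (x + y)"
        using re_le_norm[of "blinfun_apply v (x + y)"] norm_blinfun[of v "x + y"] v(2) by simp
      finally show ?thesis using \<eta>(1,2) by simp
    qed
    ultimately show "1 - \<delta> < re (blinfun_apply w y) \<and> norm x + 1 - \<delta> \<le> norm (x + y)" ..
  qed
qed

lemma daugavet_slice_refine_finite:
  assumes W: "dual_subspace scale W" "norming W" "daugavet_wrt scale W" "W \<inter> sphere 0 1 \<noteq> {}"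
    and \<delta>: "0 < \<delta>" and F: "finite F"
  shows "\<exists>w\<in>W. \<exists>\<delta>'. norm w = 1 \<and> 0 < \<delta>' \<and> \<delta>' \<le> \<delta> \<and>
    (\<forall>y. norm y \<le> 1 \<longrightarrow> 1 - \<delta>' < re (blinfun_apply w y) \<longrightarrow>
       (\<forall>x\<in>F. norm x + 1 - \<delta> \<le> norm (x + y)))"
  using F
proof induction
  case empty
  with W(4) \<delta> show ?case by auto
next
  case (insert x F)
  then obtain w \<delta>' where w: "w \<in> W" "norm w = 1" and \<delta>': "0 < \<delta>'" "\<delta>' \<le> \<delta>"
    and F: "\<And>y x. norm y \<le> 1 \<Longrightarrow> 1 - \<delta>' < re (blinfun_apply w y) \<Longrightarrow> x \<in> F \<Longrightarrow>
       norm x + 1 - \<delta> \<le> norm (x + y)"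
    by blast
  obtain w' \<delta>'' where w': "w' \<in> W" "norm w' = 1" "0 < \<delta>''"
    and x: "\<And>y. norm y \<le> 1 \<Longrightarrow> 1 - \<delta>'' < re (blinfun_apply w' y) \<Longrightarrow>
        1 - \<delta>' < re (blinfun_apply w y) \<and> norm x + 1 - \<delta>' \<le> norm (x + y)"
    using daugavet_slice_refine[OF W w \<delta>'(1), of x] by blast
  have "norm z + 1 - \<delta> \<le> norm (z + y)"
    if "norm y \<le> 1" "1 - min \<delta>'' \<delta> < re (blinfun_apply w' y)" "z \<in> insert x F" for y z
    using F[of y z] x[of y] that \<delta>'(2) by fastforce
  then show ?case using w' \<delta> by (intro bexI[of _ w'] exI[of _ "min \<delta>'' \<delta>"]) auto
qed

theorem almost_daugavet_imp_thickness_two: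
  assumes "almost_daugavet scale"
  shows "thickness_two TYPE('a)"
proof -
  obtain W where W: "dual_subspace scale W" "norming W" "daugavet_wrt scale W"
    using assms by (auto simp: almost_daugavet_def)
  \<comment> \<open>If the sphere of \<open>W\<close> were empty, the supremum of the empty set would be the norm of every vector, so the space would be \<open>{0}\<close>, where the identity has norm 0.\<close>
  have ne: "W \<inter> sphere 0 1 \<noteq> {}"
  proof
    assume "W \<inter> sphere 0 1 = {}"
    with W(2) have "norm x = (SUP w\<in>{}. 0)" for x :: 'a
      by (metis (no_types, lifting) image_empty norming_def)
    then have "norm x = norm (0::'a)" for x :: 'a by metis
    then have triv: "x = 0" for x :: 'a by simp
    have "onorm f = 0" for f :: "'a \<Rightarrow> 'a"
    proof -
      have "f = (\<lambda>_. 0)" using triv by blast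
      then show ?thesis by (simp add: onorm_zero)
    qed
    moreover have "onorm (\<lambda>z. z + tensor_op scale 0 0 z) = 1 + onorm (tensor_op scale 0 (0::'a))"
      using W(3) dual_subspace_closed(1)[OF W(1)] by (auto simp: daugavet_wrt_def)
    ultimately show False by simp
  qed
  show ?thesis
    unfolding thickness_two_def
  proof (intro allI impI)
    fix F :: "'a set" and \<epsilon> :: real assume "finite F" "0 < \<epsilon>"
    then obtain w \<delta> where w: "w \<in> W" "norm w = 1" and \<delta>: "0 < \<delta>"
      and F: "\<And>y x. norm y \<le> 1 \<Longrightarrow> 1 - \<delta> < re (blinfun_apply w y) \<Longrightarrow> x \<in> F \<Longrightarrow>
         norm x + 1 - \<epsilon> \<le> norm (x + y)"
      using daugavet_slice_refine_finite[OF W ne, of \<epsilon> F] by blast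
    have "\<exists>y. norm y \<le> 1 \<and> 1 - \<delta> < re (blinfun_apply w y)"
    proof (rule ccontr)
      assume no: "\<not> (\<exists>y. norm y \<le> 1 \<and> 1 - \<delta> < re (blinfun_apply w y))"
      have "norm (blinfun_apply w x) \<le> (1 - \<delta>) * norm x" for x
      proof (cases "x = 0")
        case False
        obtain u where u: "norm u = 1" "u * blinfun_apply w x = of_real (norm (blinfun_apply w x))"
          by (rule unit_scalar_rotation)
        let ?y = "scale (of_real (inverse (norm x)) * u) x"
        have "blinfun_apply w ?y = of_real (inverse (norm x)) * (u * blinfun_apply w x)"
          using dual_spaceD[OF dual_subspace_closed(4)[OF W(1) w(1)]] by (simp add: mult.assoc)
        then have "re (blinfun_apply w ?y) = norm (blinfun_apply w x) / norm x"
          by (simp only: u(2) re_of_real_mult re_of_real) (simp add: divide_inverse)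
        moreover have "norm ?y = 1"
          using False u(1) by (simp add: norm_scale norm_mult norm_inverse)
        ultimately have "norm (blinfun_apply w x) / norm x \<le> 1 - \<delta>"
          using no by (metis order_refl not_le)
        then show ?thesis using False by (simp add: pos_divide_le_eq)
      qed simp
      moreover have "1 - \<delta> \<ge> 0"
      proof -
        have "re (blinfun_apply w 0) = 0" using re_of_real[of 0] by simp
        then show ?thesis using no by (force dest: spec[of _ 0])
      qed
      ultimately have "norm w \<le> 1 - \<delta>" by (intro norm_blinfun_bound)
      with w(2) \<delta> show False by simp
    qed
    then show "\<exists>e. norm e \<le> 1 \<and> (\<forall>x\<in>F. norm x + 1 - \<epsilon> \<le> norm (x + e))" using F by blast
  qed
qed

end

lemma thickness_two_l1_sum:
  assumes "thickness_two TYPE('a::banach)"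
  shows "thickness_two TYPE(('a, 'b::banach) l1_sum)"
  unfolding thickness_two_def
proof (intro allI impI)
  fix F :: "('a, 'b) l1_sum set" and \<epsilon> :: real assume "finite F" "0 < \<epsilon>"
  then obtain e where e: "norm e \<le> 1"
    "\<And>x. x \<in> l1_fst ` F \<Longrightarrow> norm x + 1 - \<epsilon> \<le> norm (x + e)"
    using thickness_twoD[OF assms, of "l1_fst ` F" \<epsilon>] by blast
  then show "\<exists>e. norm e \<le> 1 \<and> (\<forall>p\<in>F. norm p + 1 - \<epsilon> \<le> norm (p + e))"
    by (intro exI[of _ "L1_Pair e 0"]) (fastforce simp: norm_l1_sum_def plus_l1_sum_def)
qed

section \<open>Directions almost orthogonal to a finite-dimensional subspace\<close>

context banach_re
begin

lemma bounded_scalars_totally_bounded: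
  assumes "0 < (\<delta>::real)"
  obtains K :: "'k set" where "finite K" "\<And>c. norm c \<le> R \<Longrightarrow> \<exists>k\<in>K. norm (c - k) < \<delta>"
proof -
  obtain K :: "'k set" where "finite K" "cball 0 R \<subseteq> (\<Union>k\<in>K. ball k \<delta>)"
    using compactE_image[OF compact_cball[of "0::'k" R], of "cball 0 R" "\<lambda>k. ball k \<delta>"] assms
    by (metis UN_I centre_in_ball open_ball subsetI)
  then show thesis
    by (intro that[of K]) (fastforce simp: subset_eq dist_norm norm_minus_commute)+
qed

text \<open>
  By induction on the spanning set.  If the new vector \<open>a\<close> has positive distance from the span
  of the others, bounded vectors have bounded coefficients and components, and the two nets are combined.
  If the distance is 0, multiples of \<open>a\<close> can be replaced by elements of the old span within any
  error, and a net for a slightly larger ball of the old span serves.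
\<close>

lemma span_totally_bounded:
  assumes "finite F" "0 < \<delta>"
  shows "\<exists>N. finite N \<and> (\<forall>u\<in>span F. norm u \<le> R \<longrightarrow> (\<exists>v\<in>N. norm (u - v) < \<delta>))"
  using assms
proof (induction F arbitrary: R \<delta>)
  case empty
  then show ?case by (intro exI[of _ "{0}"]) (simp add: span_empty)
next
  case (insert a F)
  have decomp: "\<exists>k x. u = scale k a + x \<and> x \<in> span F" if u: "u \<in> span (insert a F)" for u
  proof -
    obtain k where "u - scale k a \<in> span F" using u by (auto simp: span_insert)
    then show ?thesis by (intro exI[of _ k] exI[of _ "u - scale k a"]) simp
  qed
  show ?case
  proof (cases "\<exists>r>0. \<forall>x\<in>span F. r \<le> norm (a + x)")
    case True
    then obtain r where r: "0 < r" "\<And>x. x \<in> span F \<Longrightarrow> r \<le> norm (a + x)" by blast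
    have coeff: "norm k * r \<le> norm (scale k a + x)" if "x \<in> span F" for k x
    proof (cases "k = 0")
      case False
      have "norm k * r \<le> norm k * norm (a + scale (inverse k) x)"
        using r(2)[OF span_scale[OF that]] by (intro mult_left_mono) auto
      also have "\<dots> = norm (scale k a + x)"
        using False by (simp add: scale_right_distrib flip: norm_scale)
      finally show ?thesis .
    qed simp
    obtain K :: "'k set" where K: "finite K"
      "\<And>c. norm c \<le> R / r \<Longrightarrow> \<exists>k\<in>K. norm (c - k) < \<delta> / (2 * (norm a + 1))"
      using bounded_scalars_totally_bounded[of "\<delta> / (2 * (norm a + 1))" "R / r"] insert.prems
        add_nonneg_pos[of "norm a" 1] by auto
    obtain N where N: "finite N"
      "\<And>x. x \<in> span F \<Longrightarrow> norm x \<le> R + R / r * norm a \<Longrightarrow> \<exists>v\<in>N. norm (x - v) < \<delta> / 2"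
      using insert.IH[of "\<delta> / 2" "R + R / r * norm a"] insert.prems by auto
    show ?thesis
    proof (intro exI conjI ballI impI)
      show "finite ((\<lambda>(k, v). scale k a + v) ` (K \<times> N))" using K(1) N(1) by simp
      fix u assume u: "u \<in> span (insert a F)" "norm u \<le> R"
      then obtain k x where ux: "u = scale k a + x" and x: "x \<in> span F" using decomp by blast
      have k: "norm k \<le> R / r"
        using coeff[OF x, of k] u(2) r(1) by (simp add: ux field_simps)
      have "norm x \<le> norm u + norm (scale k a)"
        using norm_triangle_ineq4[of u "scale k a"] by (simp add: ux)
      also have "\<dots> \<le> R + R / r * norm a"
        using u(2) mult_right_mono[OF k, of "norm a"] by (simp add: norm_scale)
      finally obtain v where v: "v \<in> N" "norm (x - v) < \<delta> / 2" using N(2)[OF x] by blast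
      obtain k' where k': "k' \<in> K" "norm (k - k') < \<delta> / (2 * (norm a + 1))" using K(2)[OF k] by blast
      have "norm (k - k') * norm a \<le> norm (k - k') * (norm a + 1)"
        by (intro mult_left_mono) auto
      also have "\<dots> < \<delta> / 2"
        using k'(2) add_nonneg_pos[of "norm a" 1] by (simp add: field_simps)
      finally have "norm (scale (k - k') a) < \<delta> / 2" by (simp add: norm_scale)
      then have "norm (scale (k - k') a + (x - v)) < \<delta>"
        using v(2) norm_triangle_ineq[of "scale (k - k') a" "x - v"] by linarith
      moreover have "u - (scale k' a + v) = scale (k - k') a + (x - v)"
        by (simp add: ux scale_left_diff_distrib)
      ultimately have "norm (u - (scale k' a + v)) < \<delta>" by (simp only:)
      then show "\<exists>v\<in>(\<lambda>(k, v). scale k a + v) ` (K \<times> N). norm (u - v) < \<delta>"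
        using k'(1) v(1) by force
    qed
  next
    case False
    obtain N where N: "finite N"
      "\<And>x. x \<in> span F \<Longrightarrow> norm x \<le> R + \<delta> / 2 \<Longrightarrow> \<exists>v\<in>N. norm (x - v) < \<delta> / 2"
      using insert.IH[of "\<delta> / 2" "R + \<delta> / 2"] insert.prems by auto
    show ?thesis
    proof (intro exI conjI ballI impI)
      show "finite N" by (fact N(1))
      fix u assume u: "u \<in> span (insert a F)" "norm u \<le> R"
      then obtain k x where ux: "u = scale k a + x" and x: "x \<in> span F" using decomp by blast
      have "0 < \<delta> / (2 * (norm k + 1))"
        using insert.prems add_nonneg_pos[of "norm k" 1] by simp
      then obtain y where y: "y \<in> span F" "norm (a + y) < \<delta> / (2 * (norm k + 1))"
        using False by (meson not_le)
      have "norm k * norm (a + y) \<le> (norm k + 1) * norm (a + y)"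
        by (intro mult_right_mono) auto
      also have "\<dots> < \<delta> / 2"
        using y(2) add_nonneg_pos[of "norm k" 1] by (simp add: field_simps)
      finally have close: "norm (u - (x - scale k y)) < \<delta> / 2"
        by (simp add: ux scale_right_distrib flip: norm_scale)
      have "norm (x - scale k y) \<le> R + \<delta> / 2"
        using close u(2) norm_triangle_ineq3[of u "x - scale k y"] by linarith
      then obtain v where v: "v \<in> N" "norm (x - scale k y - v) < \<delta> / 2"
        using N(2)[OF span_diff[OF x span_scale[OF y(1)]]] by blast
      have "norm (u - v) < \<delta>"
        using norm_triangle_ineq[of "u - (x - scale k y)" "x - scale k y - v"] close v(2) by simp
      with v(1) show "\<exists>v\<in>N. norm (u - v) < \<delta>" by blast
    qed
  qed
qed

text \<open>
  Choosing \<open>e\<close> for a finite net of the unit ball of the span yields the estimate on that ball.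
  For longer \<open>u\<close> it follows from the triangle inequality after normalising, and for general \<open>c\<close>
  by homogeneity, since the span is closed under scalars.
\<close>

lemma thickness_two_l1_direction:
  assumes thick: "thickness_two TYPE('a)" and F: "finite F" and t: "0 \<le> t" "t < 1"
  obtains e where "norm e \<le> 1"
    "\<And>u c. u \<in> span F \<Longrightarrow> t * (norm u + norm c) \<le> norm (u + scale c e)"
proof -
  let ?\<delta> = "(1 - t) / 3"
  obtain N where N: "finite N"
    "\<And>u. u \<in> span F \<Longrightarrow> norm u \<le> 1 \<Longrightarrow> \<exists>v\<in>N. norm (u - v) < ?\<delta>"
    using span_totally_bounded[OF F, of ?\<delta> 1] t by auto
  obtain e where e: "norm e \<le> 1" "\<And>v. v \<in> N \<Longrightarrow> norm v + 1 - ?\<delta> \<le> norm (v + e)"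
    using thickness_twoD[OF thick N(1), of ?\<delta>] t by auto
  have ball: "norm u + t \<le> norm (u + e)" if u: "u \<in> span F" "norm u \<le> 1" for u
  proof -
    obtain v where v: "v \<in> N" "norm (u - v) < ?\<delta>" using N(2)[OF u] by blast
    have "norm u \<le> norm v + norm (u - v)" "norm (v + e) \<le> norm (u + e) + norm (u - v)"
      using norm_triangle_ineq[of v "u - v"] norm_triangle_ineq4[of "u + e" "u - v"]
      by (simp_all add: algebra_simps)
    moreover have "3 * ?\<delta> = 1 - t" by simp
    ultimately show ?thesis using e(2)[OF v(1)] v(2) by linarith
  qed
  have unit: "t * (norm u + 1) \<le> norm (u + e)" if u: "u \<in> span F" for u
  proof (cases "norm u \<le> 1")
    case True
    have "t * norm u \<le> 1 * norm u" using t by (intro mult_right_mono) auto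
    with ball[OF u True] show ?thesis by (simp add: distrib_left)
  next
    case False
    let ?u = "scale (of_real (inverse (norm u))) u"
    have "u \<noteq> 0" using False by auto
    then have "norm ?u = 1" by (simp add: norm_scale norm_inverse)
    then have "1 + t \<le> norm (?u + e)" using ball[of ?u] span_scale[OF u] by simp
    then have "norm u * (1 + t) \<le> norm (norm u *\<^sub>R (?u + e))"
      by (simp add: mult_left_mono)
    also have "norm u *\<^sub>R (?u + e) = (u + e) + (norm u - 1) *\<^sub>R e"
      unfolding scale_of_real using \<open>u \<noteq> 0\<close> by (simp add: scaleR_right_distrib scaleR_left_diff_distrib)
    also have "norm \<dots> \<le> norm (u + e) + norm ((norm u - 1) *\<^sub>R e)" by (rule norm_triangle_ineq)
    also have "norm ((norm u - 1) *\<^sub>R e) \<le> norm u - 1"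
      using False e(1) by (simp add: mult_left_le)
    finally show ?thesis using t(2) by (simp add: algebra_simps)
  qed
  show thesis
  proof (rule that[OF e(1)])
    fix u c assume u: "u \<in> span F"
    show "t * (norm u + norm c) \<le> norm (u + scale c e)"
    proof (cases "c = 0")
      case True
      have "t * norm u \<le> 1 * norm u" using t by (intro mult_right_mono) auto
      with True show ?thesis by simp
    next
      case False
      have "t * (norm u + norm c) = norm c * (t * (norm (scale (inverse c) u) + 1))"
        using False by (simp add: norm_scale norm_inverse distrib_left)
      also have "\<dots> \<le> norm c * norm (scale (inverse c) u + e)"
        using unit[OF span_scale[OF u]] by (intro mult_left_mono) auto
      also have "\<dots> = norm (u + scale c e)"
        using False by (simp add: scale_right_distrib flip: norm_scale)
      finally show ?thesis .
    qed
  qed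
qed

end

section \<open>A norming Daugavet subspace from an asymptotic l1-sequence\<close>

text \<open>
  The multiplicative errors are written as quotients \<open>\<eta> n / \<eta> (Suc n)\<close>, so that their product
  from \<open>m\<close> to \<open>N\<close> telescopes to \<open>\<eta> m / \<eta> N\<close>, which is at least \<open>\<eta> m\<close>.
  The sets \<open>S n\<close> play the role of the generators of the subspaces \<open>E n\<close>.
\<close>

locale l1_sequence = banach_re scale re
  for scale :: "'k::{real_normed_field, heine_borel} \<Rightarrow> 'a::banach \<Rightarrow> 'a" and re :: "'k \<Rightarrow> real" +
  fixes d e :: "nat \<Rightarrow> 'a" and S :: "nat \<Rightarrow> 'a set" and \<eta> :: "nat \<Rightarrow> real"
  assumes S_mono: "m \<le> n \<Longrightarrow> S m \<subseteq> S n"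
    and d_in_S: "d n \<in> S n"
    and e_in_S: "e n \<in> S (Suc n)"
    and norm_d: "norm (d n) \<le> 1"
    and norm_e: "norm (e n) \<le> 1"
    and \<eta>_pos: "0 < \<eta> n"
    and \<eta>_less: "\<eta> n < 1"
    and \<eta>_tendsto: "\<eta> \<longlonglongrightarrow> 1"
    and l1_step: "u \<in> span (S n) \<Longrightarrow> \<eta> n * (norm u + norm c) \<le> \<eta> (Suc n) * norm (u + scale c (e n))"
    and dense: "0 < \<epsilon> \<Longrightarrow> \<exists>y. norm (y - x) < \<epsilon> \<and> (\<forall>m. \<exists>n\<ge>m. d n = sgn y)"
begin

text \<open>
  These spaces increase with \<open>m\<close>; their union is the subspace with respect to which the space has
  the Daugavet property.
\<close>

definition coupled :: "nat \<Rightarrow> ('a \<Rightarrow>\<^sub>L 'k) set" where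
  "coupled m = {w \<in> dual_space scale. \<forall>n\<ge>m. blinfun_apply w (e n) = blinfun_apply w (d n)}"

lemma coupled_mono: "m \<le> n \<Longrightarrow> coupled m \<subseteq> coupled n"
  by (auto simp: coupled_def)

lemma dual_subspace_coupled: "dual_subspace scale (\<Union>m. coupled m)"
  unfolding dual_subspace_def module.subspace_def[OF module_dual_scale]
proof (intro conjI ballI allI)
  show "(\<Union>m. coupled m) \<subseteq> dual_space scale" by (auto simp: coupled_def)
  show "0 \<in> (\<Union>m. coupled m)" by (auto simp: coupled_def dual_space_def)
  show "dual_scale c w \<in> (\<Union>m. coupled m)" if "w \<in> (\<Union>m. coupled m)" for c w
    using that by (auto simp: coupled_def dual_space_def algebra_simps)
  fix v w assume "v \<in> (\<Union>m. coupled m)" "w \<in> (\<Union>m. coupled m)"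
  then obtain i j where "v \<in> coupled i" "w \<in> coupled j" by blast
  then have "v \<in> coupled (max i j)" "w \<in> coupled (max i j)"
    using coupled_mono[of i "max i j"] coupled_mono[of j "max i j"] by auto
  then have "v + w \<in> coupled (max i j)"
    by (auto simp: coupled_def dual_space_def blinfun.add_left distrib_left)
  then show "v + w \<in> (\<Union>m. coupled m)" by blast
qed

lemma dense_in_spans:
  assumes "0 < \<epsilon>"
  obtains y m where "norm (y - x) < \<epsilon>" "\<And>n. m \<le> n \<Longrightarrow> y \<in> span (S n)"
proof -
  obtain y m where y: "norm (y - x) < \<epsilon>" "d m = sgn y"
    using dense[OF assms, of x] by blast
  have "y = scale (of_real (norm y)) (d m)"
    by (cases "y = 0") (simp_all add: y(2) scale_of_real sgn_div_norm)
  then have "y \<in> span (S n)" if "m \<le> n" for n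
    using S_mono[OF that] d_in_S[of m] by (metis span_base span_scale subsetD)
  with y(1) that show thesis by blast
qed

text \<open>
  Induction on \<open>N\<close>: the part of the vector before the last \<open>k * e N\<close>, with \<open>k * d N\<close> subtracted,
  lies in \<open>span (S N)\<close>.  Adding \<open>k * e N\<close> to it costs a factor \<open>\<eta> (Suc N) / \<eta> N\<close> at most against
  adding \<open>k * d N\<close>, because \<open>e N\<close> is almost \<open>l\<^sub>1\<close>-orthogonal and \<open>d N\<close> has norm at most 1.
\<close>

lemma norm_le_norm_add_differences:
  assumes "m \<le> N" "u \<in> span (S m)" "z \<in> span ((\<lambda>i. e i - d i) ` {m..<N})"
  shows "\<eta> m * norm u \<le> \<eta> N * norm (u + z)"
  using assms(1,3)
proof (induction N arbitrary: z rule: dec_induct)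
  case base
  then show ?case by (simp add: span_empty)
next
  case (step N)
  have "{m..<Suc N} = insert N {m..<N}" using step.hyps by auto
  then obtain k where k: "z - scale k (e N - d N) \<in> span ((\<lambda>i. e i - d i) ` {m..<N})"
    using step.prems by (auto simp: span_insert)
  let ?z = "z - scale k (e N - d N)"
  have "(\<lambda>i. e i - d i) ` {m..<N} \<subseteq> span (S N)"
  proof clarify
    fix i assume "i \<in> {m..<N}"
    then have "e i \<in> S N" "d i \<in> S N"
      using e_in_S[of i] S_mono[of "Suc i" N] d_in_S[of i] S_mono[of i N] by auto
    then show "e i - d i \<in> span (S N)" by (intro span_diff span_base)
  qed
  then have z: "?z \<in> span (S N)" using k span_minimal[OF _ subspace_span] by blast
  have u: "u \<in> span (S N)" using assms(2) span_mono[OF S_mono[of m N]] step.hyps by auto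
  let ?v = "u + ?z - scale k (d N)"
  have v: "?v \<in> span (S N)"
    by (rule span_diff[OF span_add[OF u z] span_scale[OF span_base[OF d_in_S]]])
  have "norm (u + ?z) \<le> norm ?v + norm (scale k (d N))"
    using norm_triangle_ineq[of ?v "scale k (d N)"] by simp
  also have "\<dots> \<le> norm ?v + norm k"
    using norm_d[of N] by (simp add: norm_scale mult_left_le)
  finally have "\<eta> N * norm (u + ?z) \<le> \<eta> N * (norm ?v + norm k)"
    using \<eta>_pos[of N] by (simp add: mult_left_mono)
  also have "\<dots> \<le> \<eta> (Suc N) * norm (?v + scale k (e N))" by (rule l1_step[OF v])
  also have "?v + scale k (e N) = u + z" by (simp add: scale_right_diff_distrib)
  finally show ?case using step.IH[OF k] by simp
qed

lemma norm_le_infdist_differences: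
  assumes u: "u \<in> span (S m)"
  shows "\<eta> m * norm u \<le> infdist u (span ((\<lambda>i. e i - d i) ` {m..}))"
proof -
  let ?f = "\<lambda>i. e i - d i"
  have le: "\<eta> m * norm u \<le> norm (u - z)" if z: "z \<in> span (?f ` {m..})" for z
  proof -
    obtain T r where T: "finite T" "T \<subseteq> ?f ` {m..}" "z = (\<Sum>a\<in>T. scale (r a) a)"
      using z by (auto simp: span_explicit)
    obtain I where I: "I \<subseteq> {m..}" "finite I" "T = ?f ` I"
      using finite_subset_image[OF T(1,2)] by blast
    obtain N where N: "I \<subseteq> {..<N}" using finite_nat_bounded[OF I(2)] by blast
    have "I \<subseteq> {m..<max m N}" using I(1) N by fastforce
    then have "T \<subseteq> ?f ` {m..<max m N}" unfolding I(3) by (rule image_mono)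
    then have "- z \<in> span (?f ` {m..<max m N})"
      unfolding T(3) by (intro span_neg span_sum span_scale span_base) auto
    then have "\<eta> m * norm u \<le> \<eta> (max m N) * norm (u + - z)"
      by (intro norm_le_norm_add_differences u) auto
    also have "\<dots> \<le> 1 * norm (u + - z)"
      using \<eta>_less[of "max m N"] by (intro mult_right_mono) auto
    finally show ?thesis by simp
  qed
  have "span (?f ` {m..}) \<noteq> {}" using span_zero by blast
  then show ?thesis using le by (auto simp: infdist_notempty dist_norm intro: cINF_greatest)
qed

text \<open>
  Approximate \<open>x\<close> by a vector \<open>y\<close> that lies in \<open>span (S n)\<close> for all large \<open>n\<close>.  A functional that
  vanishes on \<open>e i - d i\<close> for \<open>i \<ge> n\<close> belongs to \<open>coupled n\<close>, and it can be chosen with the distance of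
  \<open>y\<close> from the span of these differences as a lower bound at \<open>y\<close>, which is at least \<open>\<eta> n * norm y\<close>.
\<close>

lemma coupled_almost_norming:
  assumes t: "t < norm x"
  obtains w m where "w \<in> coupled m" "norm w \<le> 1" "t < norm (blinfun_apply w x)"
proof -
  let ?\<delta> = "(norm x - t) / 3"
  obtain y m where y: "norm (y - x) < ?\<delta>" "\<And>n. m \<le> n \<Longrightarrow> y \<in> span (S n)"
    using dense_in_spans[of ?\<delta> x] t by auto
  have "norm x \<le> norm y + norm (y - x)"
    using norm_triangle_ineq[of y "x - y"] by (simp add: norm_minus_commute)
  moreover have "3 * ?\<delta> = norm x - t" by simp
  ultimately have "t + ?\<delta> < 1 * norm y" using y(1) t by linarith
  moreover have "(\<lambda>n. \<eta> n * norm y) \<longlonglongrightarrow> 1 * norm y" by (intro tendsto_intros \<eta>_tendsto)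
  ultimately have "eventually (\<lambda>n. t + ?\<delta> < \<eta> n * norm y) sequentially"
    by (intro order_tendstoD(1))
  then obtain n where n: "m \<le> n" "t + ?\<delta> < \<eta> n * norm y"
    by (metis (no_types, lifting) eventually_sequentially linear order_refl order_trans)
  obtain w where w: "w \<in> dual_space scale" "norm w \<le> 1"
    "\<And>z. z \<in> span ((\<lambda>i. e i - d i) ` {n..}) \<Longrightarrow> blinfun_apply w z = 0"
    "infdist y (span ((\<lambda>i. e i - d i) ` {n..})) \<le> norm (blinfun_apply w y)"
    using annihilator_functional[OF subspace_span] by blast
  have "blinfun_apply w (e i - d i) = 0" if "n \<le> i" for i
    using that by (intro w(3) span_base) auto
  then have "w \<in> coupled n" using w(1) by (auto simp: coupled_def blinfun.diff_right)
  moreover have "norm (blinfun_apply w (y - x)) \<le> norm (y - x)"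
    using norm_blinfun[of w "y - x"] w(2) mult_right_mono[of "norm w" 1 "norm (y - x)"] by simp
  then have "t < norm (blinfun_apply w x)"
    using norm_le_infdist_differences[OF y(2)[OF n(1)]] w(4) n(2) y(1)
      norm_triangle_ineq2[of "blinfun_apply w y" "blinfun_apply w x"]
    unfolding blinfun.diff_right by linarith
  ultimately show thesis using w(2) that by blast
qed

lemma norming_coupled:
  assumes "thickness_two TYPE('a)"
  shows "norming (\<Union>m. coupled m)"
proof -
  let ?W = "\<Union>m. coupled m"
  have unit: "\<exists>w\<in>?W. norm w = 1 \<and> t \<le> norm (blinfun_apply w x)" if t: "0 \<le> t" "t < norm x" for t x
  proof -
    obtain w m where w: "w \<in> coupled m" "norm w \<le> 1" "t < norm (blinfun_apply w x)"
      using coupled_almost_norming[OF t(2)] by blast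
    have "w \<noteq> 0" using w(3) t(1) by auto
    let ?v = "dual_scale (of_real (inverse (norm w))) w"
    have "t \<le> norm (blinfun_apply w x)" using w(3) by simp
    also have "\<dots> \<le> inverse (norm w) * norm (blinfun_apply w x)"
      using w(2) \<open>w \<noteq> 0\<close> mult_right_mono[of 1 "inverse (norm w)" "norm (blinfun_apply w x)"]
      by (simp add: one_le_inverse)
    finally have "t \<le> norm (blinfun_apply ?v x)" by (simp add: norm_mult norm_inverse)
    moreover have "norm ?v = 1" using \<open>w \<noteq> 0\<close> by (simp add: norm_dual_scale norm_inverse)
    moreover have "?v \<in> ?W"
      using w(1) by (intro dual_subspace_closed(3)[OF dual_subspace_coupled]) auto
    ultimately show ?thesis by blast
  qed
  obtain x :: 'a where "norm (0::'a) + 1 - 1 / 2 \<le> norm (0 + x)"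
    by (rule thickness_twoD[OF assms, of "{0}" "1 / 2"]) auto
  then have "0 < norm x" by auto
  then obtain w0 where w0: "w0 \<in> ?W" "norm w0 = 1" using unit[of 0 x] by auto
  show ?thesis
  proof (rule normingI)
    have "w0 \<in> ?W \<inter> sphere 0 1" using w0 by (simp only: Int_iff mem_sphere_0 simp_thms)
    then show "?W \<inter> sphere 0 1 \<noteq> {}" by blast
    show "\<exists>w\<in>?W. norm w = 1 \<and> t \<le> norm (blinfun_apply w x)" if "t < norm x" for x t
    proof (cases "0 \<le> t")
      case True
      with unit that show ?thesis by blast
    next
      case False
      then have "t \<le> norm (blinfun_apply w0 x)" using norm_ge_zero[of "blinfun_apply w0 x"] by linarith
      with w0 show ?thesis by blast
    qed
  qed
qed

text \<open>
  The strict inequality \<open>r * norm x < norm (w x)\<close> holds at some vector and is an open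
  condition, so it holds at a vector of the dense set, and it is invariant under normalisation.
\<close>

lemma functional_large_on_d:
  assumes r: "r < norm w"
  obtains y where "r < norm (blinfun_apply w y)" "\<And>m. \<exists>n\<ge>m. d n = y"
proof (cases "0 \<le> r")
  case False
  obtain y where "\<And>m. \<exists>n\<ge>m. d n = sgn y" using dense[of 1 0] by auto
  moreover have "r < norm (blinfun_apply w (sgn y))"
    using False by (meson norm_ge_zero not_le order_less_le_trans)
  ultimately show thesis using that by blast
next
  case True
  obtain x where x: "r * norm x < norm (blinfun_apply w x)"
    using norm_blinfun_bound[OF True, of w] r by (meson not_le)
  have "open {x. r * norm x < norm (blinfun_apply w x)}"
    by (intro open_Collect_less continuous_intros)
  then obtain \<epsilon> where \<epsilon>: "0 < \<epsilon>" "ball x \<epsilon> \<subseteq> {x. r * norm x < norm (blinfun_apply w x)}"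
    using x by (auto simp: open_contains_ball)
  obtain y where y: "norm (y - x) < \<epsilon>" "\<And>m. \<exists>n\<ge>m. d n = sgn y"
    using dense[OF \<epsilon>(1), of x] by blast
  have wy: "r * norm y < norm (blinfun_apply w y)"
    using \<epsilon>(2) y(1) by (auto simp: dist_norm norm_minus_commute)
  then have "y \<noteq> 0" by auto
  then have "r < norm (blinfun_apply w (sgn y))"
    using wy by (simp add: sgn_div_norm blinfun.scaleR_right field_simps)
  with y(2) that show thesis by blast
qed

lemma norm_add_e_large:
  assumes "0 < \<epsilon>"
  shows "\<exists>m. \<forall>n\<ge>m. norm x + 1 - \<epsilon> \<le> norm (x + e n)"
proof -
  let ?\<delta> = "\<epsilon> / 3"
  obtain y m where y: "norm (y - x) < ?\<delta>" "\<And>n. m \<le> n \<Longrightarrow> y \<in> span (S n)"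
    using dense_in_spans[of ?\<delta> x] assms by auto
  have "(\<lambda>n. \<eta> n * (norm y + 1)) \<longlonglongrightarrow> 1 * (norm y + 1)" by (intro tendsto_intros \<eta>_tendsto)
  moreover have "norm y + 1 - ?\<delta> < 1 * (norm y + 1)" using assms by simp
  ultimately have "eventually (\<lambda>n. norm y + 1 - ?\<delta> < \<eta> n * (norm y + 1)) sequentially"
    by (rule order_tendstoD)
  then obtain m' where m': "\<And>n. m' \<le> n \<Longrightarrow> norm y + 1 - ?\<delta> < \<eta> n * (norm y + 1)"
    by (auto simp: eventually_sequentially)
  have "norm x + 1 - \<epsilon> \<le> norm (x + e n)" if n: "max m m' \<le> n" for n
  proof -
    have "norm y + 1 - ?\<delta> < \<eta> n * (norm y + norm (1::'k))" using m'[of n] n by simp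
    also have "\<dots> \<le> \<eta> (Suc n) * norm (y + scale 1 (e n))"
      using y(2)[of n] n by (intro l1_step) simp
    also have "\<dots> \<le> norm (y + e n)"
      using \<eta>_less[of "Suc n"] \<eta>_pos[of "Suc n"] mult_right_mono[of "\<eta> (Suc n)" 1 "norm (y + e n)"]
      by simp
    finally show ?thesis
      using y(1) norm_triangle_ineq3[of x y] norm_triangle_ineq2[of "y + e n" "x + e n"]
      by (simp add: norm_minus_commute)
  qed
  then show ?thesis by blast
qed

text \<open>
  At the infinitely many \<open>n\<close> with \<open>d n = y\<close> the operator maps \<open>e n\<close> to \<open>e n + a x\<close> with the fixed
  scalar \<open>a = w y\<close>, and the fixed vector \<open>a x\<close> is asymptotically \<open>l\<^sub>1\<close>-additive with \<open>e n\<close>.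
\<close>

lemma daugavet_coupled: "daugavet_wrt scale (\<Union>m. coupled m)"
  unfolding daugavet_wrt_def
proof (intro ballI allI antisym)
  fix w x assume "w \<in> (\<Union>m. coupled m)"
  then obtain m0 where m0: "w \<in> coupled m0" by blast
  let ?T = "tensor_op scale w x"
  show "onorm (\<lambda>z. z + ?T z) \<le> 1 + onorm ?T"
    using onorm_triangle[OF bounded_linear_ident bounded_linear_tensor_op, of w x]
      onorm_id_le[where 'a = 'a] by simp
  have lower: "1 + norm a * norm x \<le> onorm (\<lambda>z. z + ?T z)"
    if y: "a = blinfun_apply w y" "\<And>m. \<exists>n\<ge>m. d n = y" for a y
  proof (rule field_le_epsilon)
    fix \<epsilon> :: real assume "0 < \<epsilon>"
    then obtain m where m: "\<And>n. m \<le> n \<Longrightarrow>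
        norm (scale a x) + 1 - \<epsilon> \<le> norm (scale a x + e n)"
      using norm_add_e_large[of \<epsilon> "scale a x"] by blast
    obtain n where n: "max m m0 \<le> n" "d n = y" using y(2) by blast
    have "blinfun_apply w (e n) = a"
      using m0 n y(1) by (simp add: coupled_def)
    then have "norm (scale a x) + 1 - \<epsilon> \<le> norm (e n + ?T (e n))"
      using m[of n] n(1) by (simp add: tensor_op_def add.commute)
    also have "\<dots> \<le> onorm (\<lambda>z. z + ?T z) * norm (e n)"
      by (rule onorm[OF bounded_linear_id_plus_tensor_op])
    also have "\<dots> \<le> onorm (\<lambda>z. z + ?T z)"
      using norm_e[of n] onorm_pos_le[OF bounded_linear_id_plus_tensor_op, of w x]
      by (simp add: mult_left_le)
    finally show "1 + norm a * norm x \<le> onorm (\<lambda>z. z + ?T z) + \<epsilon>"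
      by (simp add: norm_scale)
  qed
  have below: "1 + r * norm x \<le> onorm (\<lambda>z. z + ?T z)" if r: "r < norm w" for r
  proof -
    obtain y where y: "r < norm (blinfun_apply w y)" "\<And>m. \<exists>n\<ge>m. d n = y"
      using functional_large_on_d[OF r] by blast
    have "1 + r * norm x \<le> 1 + norm (blinfun_apply w y) * norm x"
      using y(1) by (simp add: mult_right_mono)
    also have "\<dots> \<le> onorm (\<lambda>z. z + ?T z)" using y(2) by (intro lower[of _ y]) simp_all
    finally show ?thesis .
  qed
  have "1 + norm w * norm x \<le> onorm (\<lambda>z. z + ?T z)"
  proof (cases "x = 0")
    case True
    with below[of "norm w - 1"] show ?thesis by simp
  next
    case False
    have "norm w \<le> (onorm (\<lambda>z. z + ?T z) - 1) / norm x"
      by (rule dense_le) (use below False in \<open>simp add: field_simps\<close>)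
    then show ?thesis using False by (simp add: field_simps)
  qed
  then show "1 + onorm ?T \<le> onorm (\<lambda>z. z + ?T z)" by (simp add: onorm_tensor_op)
qed

end

section \<open>Separability and the l1-sum\<close>

lemma separable_dense_sequence:
  assumes "separable_space (euclidean :: 'a::metric_space topology)"
  obtains c :: "nat \<Rightarrow> 'a::metric_space" where "\<And>x \<epsilon>. 0 < \<epsilon> \<Longrightarrow> \<exists>k. dist (c k) x < \<epsilon>"
proof -
  obtain C :: "'a set" where C: "countable C" "closure C = UNIV"
    using assms by (auto simp: separable_space_def)
  then have "C \<noteq> {}" by auto
  show thesis
  proof (rule that[of "from_nat_into C"])
    fix x :: 'a and \<epsilon> :: real assume "0 < \<epsilon>"
    moreover have "x \<in> closure C" using C(2) by simp
    ultimately obtain y where "y \<in> C" "dist y x < \<epsilon>"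
      unfolding closure_approachable by blast
    then show "\<exists>k. dist (from_nat_into C k) x < \<epsilon>"
      using from_nat_into_surj[OF C(1)] by metis
  qed
qed

lemma l1_sum_dense_sequence:
  assumes "separable_space (euclidean :: 'a::banach topology)"
    and "separable_space (euclidean :: 'b::banach topology)"
  obtains c :: "nat \<Rightarrow> ('a::banach, 'b::banach) l1_sum" where "\<And>p \<epsilon>. 0 < \<epsilon> \<Longrightarrow> \<exists>k. norm (c k - p) < \<epsilon>"
proof -
  obtain a :: "nat \<Rightarrow> 'a" where a: "\<And>x \<epsilon>. 0 < \<epsilon> \<Longrightarrow> \<exists>k. dist (a k) x < \<epsilon>"
    using separable_dense_sequence[OF assms(1)] by blast
  obtain b :: "nat \<Rightarrow> 'b" where b: "\<And>x \<epsilon>. 0 < \<epsilon> \<Longrightarrow> \<exists>k. dist (b k) x < \<epsilon>"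
    using separable_dense_sequence[OF assms(2)] by blast
  show thesis
  proof (rule that[of "\<lambda>k. case prod_decode k of (i, j) \<Rightarrow> L1_Pair (a i) (b j)"])
    fix p :: "('a, 'b) l1_sum" and \<epsilon> :: real assume "0 < \<epsilon>"
    then obtain i j where "dist (a i) (l1_fst p) < \<epsilon> / 2" "dist (b j) (l1_snd p) < \<epsilon> / 2"
      using a[of "\<epsilon> / 2" "l1_fst p"] b[of "\<epsilon> / 2" "l1_snd p"] by auto
    then show "\<exists>k. norm ((case prod_decode k of (i, j) \<Rightarrow> L1_Pair (a i) (b j)) - p) < \<epsilon>"
      by (intro exI[of _ "prod_encode (i, j)"])
        (simp add: norm_l1_sum_def minus_l1_sum_def dist_norm)
  qed
qed

context banach_re
begin

text \<open>
  Dependent choice of the pairs \<open>(S n, e n)\<close>, where \<open>S n\<close> is finite and contains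
  \<open>d 0, ..., d n\<close> and all earlier directions.
\<close>

lemma l1_directions_sequence:
  assumes thick: "thickness_two TYPE('a)"
    and \<eta>: "\<And>n. 0 < \<eta> n" "\<And>n. \<eta> n < \<eta> (Suc n)"
  obtains e S where "\<And>n::nat. d n \<in> S n" "\<And>n. e n \<in> S (Suc n)" "\<And>n. S n \<subseteq> S (Suc n)"
    "\<And>n. norm (e n) \<le> 1"
    "\<And>n u c. u \<in> span (S n) \<Longrightarrow> \<eta> n * (norm u + norm c) \<le> \<eta> (Suc n) * norm (u + scale c (e n))"
proof -
  let ?good = "\<lambda>n T f. \<forall>u\<in>span T. \<forall>c. \<eta> n * (norm u + norm c) \<le> \<eta> (Suc n) * norm (u + scale c f)"
  have ex: "\<exists>f. norm f \<le> 1 \<and> ?good n T f" if T: "finite T" for n T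
  proof -
    have "0 \<le> \<eta> n / \<eta> (Suc n)" "\<eta> n / \<eta> (Suc n) < 1"
      using \<eta>(1)[of n] \<eta>(1)[of "Suc n"] \<eta>(2)[of n] by auto
    then obtain f where "norm f \<le> 1"
      "\<And>u c. u \<in> span T \<Longrightarrow> \<eta> n / \<eta> (Suc n) * (norm u + norm c) \<le> norm (u + scale c f)"
      using thickness_two_l1_direction[OF thick T] by metis
    then show ?thesis
      using \<eta>(1)[of "Suc n"] by (intro exI[of _ f]) (simp add: pos_divide_le_eq mult.commute)
  qed
  let ?P = "\<lambda>n (T, f). finite T \<and> d n \<in> T \<and> norm f \<le> 1 \<and> ?good n T f"
  let ?Q = "\<lambda>n (T, f) (T', f'). T' = insert f (insert (d (Suc n)) T)"
  have "\<exists>g. \<forall>n. ?P n (g n) \<and> ?Q n (g n) (g (Suc n))"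
  proof (rule dependent_nat_choice)
    show "\<exists>x. ?P 0 x" using ex[of "{d 0}" 0] by auto
    fix x n assume x: "?P n x"
    let ?T = "insert (snd x) (insert (d (Suc n)) (fst x))"
    have T: "finite ?T" using x by (auto simp: case_prod_beta)
    then obtain f where "norm f \<le> 1" "?good (Suc n) ?T f" using ex by blast
    with T show "\<exists>y. ?P (Suc n) y \<and> ?Q n x y"
      by (intro exI[of _ "(?T, f)"]) (simp add: case_prod_beta)
  qed
  then obtain g where g: "\<And>n. ?P n (g n) \<and> ?Q n (g n) (g (Suc n))" by blast
  show thesis
    by (rule that[of "\<lambda>n. fst (g n)" "\<lambda>n. snd (g n)"]) (use g in \<open>auto simp: case_prod_beta\<close>)
qed

theorem thickness_two_imp_almost_daugavet:
  assumes thick: "thickness_two TYPE('a)"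
    and c: "\<And>x \<epsilon>. 0 < \<epsilon> \<Longrightarrow> \<exists>k::nat. norm (c k - x :: 'a) < \<epsilon>"
  shows "almost_daugavet scale"
proof -
  \<comment> \<open>The pairing makes \<open>d\<close> take each value \<open>sgn (c k)\<close> infinitely often.\<close>
  define d where "d n = sgn (c (fst (prod_decode n)))" for n
  have d: "\<exists>n\<ge>m. d n = sgn (c k)" for k m
    by (intro exI[of _ "prod_encode (k, m)"]) (simp add: d_def le_prod_encode_2)
  define \<eta> where "\<eta> n = real (Suc n) / real (Suc (Suc n))" for n
  have \<eta>: "0 < \<eta> n" "\<eta> n < 1" "\<eta> n < \<eta> (Suc n)" for n
    by (auto simp: \<eta>_def field_simps)
  have \<eta>_lim: "\<eta> \<longlonglongrightarrow> 1"
    unfolding \<eta>_def using LIMSEQ_Suc[OF LIMSEQ_n_over_Suc_n] by simp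
  obtain e S where S: "\<And>n. d n \<in> S n" "\<And>n. e n \<in> S (Suc n)" "\<And>n. S n \<subseteq> S (Suc n)"
    "\<And>n. norm (e n) \<le> 1"
    "\<And>n u c. u \<in> span (S n) \<Longrightarrow> \<eta> n * (norm u + norm c) \<le> \<eta> (Suc n) * norm (u + scale c (e n))"
    by (rule l1_directions_sequence[where \<eta> = \<eta> and d = d, OF thick \<eta>(1,3)], rule that)
  interpret l1_sequence scale re d e S \<eta>
  proof
    show "S m \<subseteq> S n" if "m \<le> n" for m n using that by (rule lift_Suc_mono_le[of S, OF S(3)])
    show "\<exists>y. norm (y - x) < \<epsilon> \<and> (\<forall>m. \<exists>n\<ge>m. d n = sgn y)" if "0 < \<epsilon>" for \<epsilon> x
      using c[OF that, of x] d by blast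
    show "norm (d n) \<le> 1" for n by (simp add: d_def norm_sgn)
  qed (fact S(1,2,4,5) \<eta>(1,2) \<eta>_lim)+
  show ?thesis
    using dual_subspace_coupled norming_coupled[OF thick] daugavet_coupled
    by (auto simp: almost_daugavet_def)
qed

end

lemma almost_daugavet_l1_sum:
  fixes sX :: "'k::{real_normed_field, heine_borel} \<Rightarrow> 'x::banach \<Rightarrow> 'x"
    and sY :: "'k \<Rightarrow> 'y::banach \<Rightarrow> 'y"
  assumes re: "real_part (re :: 'k \<Rightarrow> real)" and X: "banach_over sX" and Y: "banach_over sY"
    and sep: "separable_space (euclidean :: 'x topology)" "separable_space (euclidean :: 'y topology)"
    and ad: "almost_daugavet sX"
  shows "almost_daugavet (l1_scale sX sY)"
proof -
  interpret X: banach_re sX re using X re by (rule banach_re.intro)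
  interpret XY: banach_re "l1_scale sX sY" re
    using banach_over_l1_scale[OF X Y] re by (rule banach_re.intro)
  obtain c :: "nat \<Rightarrow> ('x, 'y) l1_sum" where c: "\<And>p \<epsilon>. 0 < \<epsilon> \<Longrightarrow> \<exists>k. norm (c k - p) < \<epsilon>"
    using l1_sum_dense_sequence[OF sep] by blast
  have "thickness_two TYPE(('x, 'y) l1_sum)"
    by (intro thickness_two_l1_sum X.almost_daugavet_imp_thickness_two ad)
  then show ?thesis using c by (rule XY.thickness_two_imp_almost_daugavet)
qed

theorem proposition2p2:
  fixes sX :: "complex \<Rightarrow> 'x::banach \<Rightarrow> 'x"
    and sY :: "complex \<Rightarrow> 'y::banach \<Rightarrow> 'y"
  assumes "separable_space (euclidean :: 'x topology)"
    and "separable_space (euclidean :: 'y topology)"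
  shows "(almost_daugavet (scaleR :: real \<Rightarrow> 'x \<Rightarrow> 'x) \<longrightarrow>
            almost_daugavet (scaleR :: real \<Rightarrow> ('x, 'y) l1_sum \<Rightarrow> ('x, 'y) l1_sum)) \<and>
         (banach_over sX \<longrightarrow> banach_over sY \<longrightarrow> almost_daugavet sX \<longrightarrow>
            almost_daugavet (l1_scale sX sY))"
proof (intro conjI impI)
  assume "almost_daugavet (scaleR :: real \<Rightarrow> 'x \<Rightarrow> 'x)"
  then have "almost_daugavet
      (l1_scale scaleR scaleR :: real \<Rightarrow> ('x, 'y) l1_sum \<Rightarrow> ('x, 'y) l1_sum)"
    by (intro almost_daugavet_l1_sum[OF real_part_real banach_over_scaleR banach_over_scaleR assms])
  then show "almost_daugavet (scaleR :: real \<Rightarrow> ('x, 'y) l1_sum \<Rightarrow> ('x, 'y) l1_sum)"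
    by (simp add: l1_scale_scaleR)
next
  assume "banach_over sX" "banach_over sY" "almost_daugavet sX"
  then show "almost_daugavet (l1_scale sX sY)"
    by (intro almost_daugavet_l1_sum[OF real_part_complex] assms)
qed

end
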